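(* Let $(\mathfrak{M},d)$ be a complete metric space, $1<p<\infty$, $\mathcal{E}:\mathfrak{M}\to(-\infty,+\infty]$ a proper functional with strong upper gradient $g$, and $v:[0,+\infty)\to\mathfrak{M}$ a $p$-gradient flow of $\mathcal{E}$ with non-empty $\omega$-limit set $\omega(v)$. Suppose that $\mathcal{E}$ is lower semicontinuous on the closure of $\{v(t):t\ge\bar t\}$ for some $\bar t\ge0$, and that for $\varphi\in\omega(v)$ with $g(\varphi)=0$ there is $\varepsilon>0$ such that $$B(\varphi,\varepsilon)\cap\{\mathcal{E}(\cdot|\varphi)>0\}\subseteq\{g>0\}.$$ If there is a strictly increasing function $\theta\in W^{1,1}_{loc}(\mathbb{R})$ with $\theta(0)=0$ and $|\{\theta>0,\ \theta'=0\}|=0$ such that $$\theta'(\mathcal{E}(u|\varphi))\,g(u)\ge1\qquad\text{for all } u\in\mathcal{U}_\varepsilon:=B(\varphi,\varepsilon)\cap\{\mathcal{E}(\cdot|\varphi)>0\}\cap\{\theta'(\mathcal{E}(\cdot|\varphi))>0\},$$ then $v$ has finite length, i.e. $\int_0^\infty|v'|(r)\,dr<\infty$, and $$\lim_{t\to\infty}v(t)=\varphi\quad\text{in }\mathfrak{M}.$$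
   Context: $p'=p/(p-1)$; $D(\mathcal{E})=\{\mathcal{E}<+\infty\}$; proper means $D(\mathcal{E})\ne\emptyset$; $\mathcal{E}(u|\varphi):=\mathcal{E}(u)-\mathcal{E}(\varphi)$; $B(\varphi,\varepsilon)$ is the open ball; $|A|$ is Lebesgue measure. $\omega(v)$ is the set of all $\psi\in\mathfrak{M}$ for which there is $t_n\uparrow+\infty$ with $v(t_n)\to\psi$. $AC(a,b;\mathfrak{M})$ (resp. $AC_{loc}$): curves $v$ with $d(v(s),v(t))\le\int_s^tm(r)\,dr$ for all $a<s\le t<b$ and some $m\in L^1(a,b)$ (resp. $L^1_{loc}$); $|v'|(t)=\lim_{s\to t}d(v(s),v(t))/|s-t|$ (exists a.e.) is the metric derivative. A proper $g:\mathfrak{M}\to[0,+\infty]$ with $\{g<\infty\}\subseteq D(\mathcal{E})$ is a strong upper gradient of $\mathcal{E}$ if for every $v\in AC(a,b;\mathfrak{M})$, $g\circ v$ is Borel and $|\mathcal{E}(v(t))-\mathcal{E}(v(s))|\le\int_s^tg(v(r))|v'|(r)\,dr$ for $a<s\le t<b$. $v:[0,\infty)\to\mathfrak{M}$ is a $p$-gradient flow of $\mathcal{E}$ if $v\in AC_{loc}(0,\infty;\mathfrak{M})$, $\mathcal{E}\circ v:(0,\infty)\to\mathbb{R}$ is non-increasing and $\frac{d}{dt}\mathcal{E}(v(t))\le-\frac1{p'}g^{p'}(v(t))-\frac1p|v'|^p(t)$ for a.e. $t>0$. Elements of $W^{1,1}_{loc}(\mathbb{R})$ are identified with continuous representatives;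 $\theta'$ is the a.e. derivative.
   Formalization: The flow is assumed absolutely continuous up to time 0 (m integrable on (0,T) for every finite T, not just locally in (0,∞)); otherwise finite length fails, e.g. v(t)=(2t)^{-1/2}, E(x)=x^4/4, g=|x|^3, p=2, φ=0, θ(s)=c·sgn(s)|s|^{1/4}, which has infinite length near t=0. *)

theory Defs
  imports "HOL-Analysis.Analysis"
begin

text \<open>
  Curves are total functions on the reals; only their values on the interval under consideration
  matter. Functionals are \<open>ereal\<close>-valued and, by \<open>proper_functional\<close>, never take the value \<open>-\<infinity>\<close>.
\<close>

definition eff_domain :: "('a \<Rightarrow> ereal) \<Rightarrow> 'a set" where
  "eff_domain E = {u. E u < \<infinity>}"

definition proper_functional :: "('a \<Rightarrow> ereal) \<Rightarrow> bool" where
  "proper_functional E \<longleftrightarrow> (\<forall>u. E u \<noteq> -\<infinity>) \<and> eff_domain E \<noteq> {}"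

definition rel_energy :: "('a \<Rightarrow> ereal) \<Rightarrow> 'a \<Rightarrow> 'a \<Rightarrow> ereal" where
  "rel_energy E \<phi> u = E u - E \<phi>"

definition lsc_on :: "'a::topological_space set \<Rightarrow> ('a \<Rightarrow> ereal) \<Rightarrow> bool" where
  "lsc_on S E \<longleftrightarrow> (\<forall>x\<in>S. E x \<le> Liminf (at x within S) E)"

definition AC :: "ereal \<Rightarrow> ereal \<Rightarrow> (real \<Rightarrow> 'a::metric_space) \<Rightarrow> bool" where
  "AC a b v \<longleftrightarrow>
     (\<exists>m. set_integrable lborel (einterval a b) m \<and>
          (\<forall>s t. a < ereal s \<and> s \<le> t \<and> ereal t < b \<longrightarrow>
             dist (v s) (v t) \<le> (LBINT r:{s..t}. m r)))"

text \<open>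
  Locality is meant relative to \<open>[a, b)\<close>, the domain of the flows below: \<open>m\<close> is integrable on
  \<open>(a, T)\<close> for every real \<open>T < b\<close>. If \<open>m\<close> were only locally integrable on the open interval
  \<open>(0, \<infinity>)\<close>, a gradient flow could have infinite length near time \<open>0\<close>: take \<open>v(t) = 1/sqrt(2t)\<close>
  and \<open>E(x) = x^4/4\<close> on the real line with \<open>p = 2\<close>.
\<close>

definition AC_loc :: "real \<Rightarrow> ereal \<Rightarrow> (real \<Rightarrow> 'a::metric_space) \<Rightarrow> bool" where
  "AC_loc a b v \<longleftrightarrow>
     (\<exists>m. (\<forall>T::real. a < T \<and> ereal T < b \<longrightarrow> set_integrable lborel (einterval a T) m) \<and>
          (\<forall>s t. a < s \<and> s \<le> t \<and> ereal t < b \<longrightarrow>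
             dist (v s) (v t) \<le> (LBINT r:{s..t}. m r)))"

text \<open>The value is meaningful only where the limit exists, i.e. almost everywhere for AC curves.\<close>

definition metric_derivative :: "(real \<Rightarrow> 'a::metric_space) \<Rightarrow> real \<Rightarrow> real" where
  "metric_derivative v t = Lim (at t) (\<lambda>s. dist (v s) (v t) / \<bar>s - t\<bar>)"

text \<open>
  The upper gradient inequality is vacuous where both energies are infinite: there the difference
  is undefined, whereas \<open>\<infinity> - \<infinity> = \<infinity>\<close> in \<open>ereal\<close> would already rule out constant curves
  outside the effective domain.
\<close>

definition strong_upper_gradient ::
  "('a::metric_space \<Rightarrow> ereal) \<Rightarrow> ('a \<Rightarrow> ennreal) \<Rightarrow> bool" where
  "strong_upper_gradient E g \<longleftrightarrow>
     {u. g u < \<infinity>} \<noteq> {} \<and> {u. g u < \<infinity>} \<subseteq> eff_domain E \<and>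
     (\<forall>a b v. AC a b v \<longrightarrow>
        (\<lambda>r. g (v r)) \<in> borel_measurable (restrict_space borel (einterval a b)) \<and>
        (\<forall>s t. a < ereal s \<and> s \<le> t \<and> ereal t < b \<and>
               \<not> (E (v s) = \<infinity> \<and> E (v t) = \<infinity>) \<longrightarrow>
           \<bar>E (v t) - E (v s)\<bar>
             \<le> enn2ereal (\<integral>\<^sup>+r\<in>{s..t}. g (v r) * ennreal (metric_derivative v r) \<partial>lborel)))"

text \<open>
  A right-hand side equal to \<open>-\<infinity>\<close> would violate the energy inequality, hence the requirement
  \<open>g (v t) < \<infinity>\<close>.
\<close>

definition gradient_flow ::
  "real \<Rightarrow> ('a::metric_space \<Rightarrow> ereal) \<Rightarrow> ('a \<Rightarrow> ennreal) \<Rightarrow> (real \<Rightarrow> 'a) \<Rightarrow> bool" where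
  "gradient_flow p E g v \<longleftrightarrow>
     AC_loc 0 \<infinity> v \<and>
     (\<forall>t>0. \<bar>E (v t)\<bar> \<noteq> \<infinity>) \<and>
     (\<forall>s t. 0 < s \<and> s \<le> t \<longrightarrow> E (v t) \<le> E (v s)) \<and>
     (let p' = p / (p - 1) in
       AE t in lborel. t > 0 \<longrightarrow>
         g (v t) < \<infinity> \<and>
         (\<exists>D. ((\<lambda>s. real_of_ereal (E (v s))) has_real_derivative D) (at t) \<and>
              D \<le> - (1 / p') * enn2real (g (v t)) powr p' - (1 / p) * metric_derivative v t powr p))"

definition omega_limit :: "(real \<Rightarrow> 'a::metric_space) \<Rightarrow> 'a set" where
  "omega_limit v =
     {\<psi>. \<exists>\<tau>::nat \<Rightarrow> real. (\<forall>n. 0 \<le> \<tau> n) \<and> incseq \<tau> \<and> filterlim \<tau> at_top sequentially \<and>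
          (\<lambda>n. v (\<tau> n)) \<longlonglongrightarrow> \<psi>}"

definition curve_length :: "(real \<Rightarrow> 'a::metric_space) \<Rightarrow> ennreal" where
  "curve_length v = (\<integral>\<^sup>+r\<in>{0<..}. ennreal (metric_derivative v r) \<partial>lborel)"

text \<open>Weak derivatives on the real line, tested against \<open>C\<^sup>1\<close> functions of compact support.\<close>

definition weak_derivative :: "(real \<Rightarrow> real) \<Rightarrow> (real \<Rightarrow> real) \<Rightarrow> bool" where
  "weak_derivative \<theta> f \<longleftrightarrow>
     (\<forall>\<eta> \<eta>'. (\<forall>x. (\<eta> has_real_derivative \<eta>' x) (at x)) \<and> continuous_on UNIV \<eta>' \<and>
             (\<exists>R. \<forall>x. R < \<bar>x\<bar> \<longrightarrow> \<eta> x = 0) \<longrightarrow>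
        (LBINT x. \<theta> x * \<eta>' x) = - (LBINT x. f x * \<eta> x))"

text \<open>The continuous representatives of the elements of \<open>W\<^sup>1\<^sup>,\<^sup>1\<close>-loc of the real line.\<close>

definition W11_loc :: "(real \<Rightarrow> real) set" where
  "W11_loc =
     {\<theta>. continuous_on UNIV \<theta> \<and>
          (\<exists>f. (\<forall>a b. set_integrable lborel {a..b} f) \<and> weak_derivative \<theta> f)}"

text \<open>
  The derivative of \<open>\<theta>\<close> exists only almost everywhere; a point belongs to this set only if
  \<open>\<theta>\<close> is differentiable at its (finite) relative energy.
\<close>

definition KL_set ::
  "('a::metric_space \<Rightarrow> ereal) \<Rightarrow> (real \<Rightarrow> real) \<Rightarrow> 'a \<Rightarrow> real \<Rightarrow> 'a set" where
  "KL_set E \<theta> \<phi> \<epsilon> =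
     ball \<phi> \<epsilon> \<inter> {u. rel_energy E \<phi> u > 0} \<inter>
     {u. rel_energy E \<phi> u < \<infinity> \<and>
         \<theta> differentiable (at (real_of_ereal (rel_energy E \<phi> u))) \<and>
         deriv \<theta> (real_of_ereal (rel_energy E \<phi> u)) > 0}"

end

theory Submission
  imports Defs
begin

text \<open>
  Let \<open>h(t) = E(v(t)) - E(\<phi>)\<close>, which is nonnegative by lower semicontinuity. While \<open>v(t)\<close> stays in the
  ball, the energy inequality, Young's inequality and the KL inequality give
  \<open>|v'| \<le> -(\<theta> \<circ> h)'\<close>. Hence the length travelled inside the ball after time \<open>T\<close> is at most
  \<open>\<theta>(h(T)) - inf (\<theta> \<circ> h)\<close>, which tends to \<open>0\<close> along the monotone function \<open>\<theta> \<circ> h\<close>. Once \<open>v(T)\<close> is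
  close to \<open>\<phi>\<close> at a late time \<open>T\<close>, the curve can no longer leave the ball. Subtracting the infimum
  covers the case that \<open>h\<close> does not tend to \<open>0\<close>.

  The bound of distances by the integral of the metric derivative rests on the Lebesgue
  differentiation theorem and on a density for the distance functions \<open>t \<mapsto> d(v(t), v(q))\<close>, which the
  Radon-Nikodym theorem provides.
\<close>

section \<open>Primitives of locally integrable functions\<close>

text \<open>The obstacle is the chain rule for \<open>\<theta> \<circ> h\<close>. The function
  \<open>\<theta>\<close> is differentiable only almost everywhere, and \<open>h\<close> could stay
  at exceptional levels during a set of times of positive measure. Such times are harmless: at
  almost all of them where \<open>h\<close> is differentiable, \<open>h' = 0\<close>, and there the
  energy inequality makes the speed vanish. Integrating the decay rate then takes only one half of
  the fundamental theorem of calculus: for a nonincreasing function the integral of minus the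
  derivative is at most the total decrease. Absolute continuity of the composition is therefore
  never invoked. For a ball of radius \<open>\<delta>\<close>, one half of the radius is reserved
  for the distance at the starting time and the other half for the remaining travel. Since
  \<open>metric_derivative\<close> is a \<open>Lim\<close>, with unspecified values where the limit
  fails to exist, it is handled only up to null sets and compared with measurable functions.\<close>

definition loc_integrable :: "(real \<Rightarrow> real) \<Rightarrow> bool" where
  "loc_integrable f \<longleftrightarrow> (\<forall>a b. set_integrable lborel {a..b} f)"

lemma negligible_imp_AE_lborel:
  fixes N :: "'a::euclidean_space set"
  assumes "negligible N"
  shows "AE x in lborel. x \<notin> N"
proof -
  have "AE x in lebesgue. x \<notin> N"
    using assms by (intro AE_not_in) (simp add: negligible_iff_null_sets)
  then show ?thesis by (simp add: AE_completion_iff)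
qed

lemma AE_lborel_imp_negligible:
  fixes P :: "'a::euclidean_space \<Rightarrow> bool"
  assumes "AE x in lborel. P x"
  shows "negligible {x. \<not> P x}"
proof -
  obtain N where N: "{x \<in> space lborel. \<not> P x} \<subseteq> N" "N \<in> null_sets lborel"
    using assms by (auto elim: AE_E3 simp: eventually_ae_filter)
  then have "negligible N"
    by (simp add: negligible_iff_null_sets null_sets_completionI)
  then show ?thesis
    by (rule negligible_subset) (use N(1) in simp)
qed

lemma loc_integrableD:
  assumes "loc_integrable f"
  shows "set_integrable lborel {a..b} f" "f integrable_on {a..b}"
    "(LBINT r:{a..b}. f r) = integral {a..b} f"
  using assms set_borel_integral_eq_integral[of "{a..b}" f] by (auto simp: loc_integrable_def)

lemma loc_integrable_measurable:
  assumes "loc_integrable f"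
  shows "f \<in> borel_measurable borel"
proof (rule borel_measurable_LIMSEQ_real)
  show "(\<lambda>x. indicator {-real n..real n} x *\<^sub>R f x) \<in> borel_measurable borel" for n
    using loc_integrableD(1)[OF assms, of "-real n" "real n"]
    by (simp add: set_integrable_def integrable_iff_bounded)
  show "(\<lambda>n. indicator {-real n..real n} x *\<^sub>R f x) \<longlonglongrightarrow> f x" for x
  proof (rule tendsto_eventually)
    obtain N where N: "\<bar>x\<bar> \<le> real N" using real_arch_simple by blast
    show "\<forall>\<^sub>F n in sequentially. indicator {-real n..real n} x *\<^sub>R f x = f x"
      using eventually_ge_at_top[of N]
    proof eventually_elim
      case (elim n)
      then have "\<bar>x\<bar> \<le> real n" using N by linarith
      then have "x \<in> {-real n..real n}" by auto
      then show ?case by simp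
    qed
  qed
qed

lemma loc_integrable_bound:
  assumes "loc_integrable f" "h \<in> borel_measurable borel" "\<And>x. \<bar>h x\<bar> \<le> \<bar>f x\<bar>"
  shows "loc_integrable h"
  unfolding loc_integrable_def
proof (intro allI)
  fix a b
  show "set_integrable lborel {a..b} h"
    by (rule set_integrable_bound[OF loc_integrableD(1)[OF assms(1)]])
       (use assms in \<open>auto simp: set_borel_measurable_def\<close>)
qed

lemma loc_integrable_abs: "loc_integrable f \<Longrightarrow> loc_integrable (\<lambda>x. \<bar>f x\<bar>)"
  by (auto simp: loc_integrable_def intro: set_integrable_abs)

lemma loc_integrable_integral_split:
  assumes "loc_integrable f" "a \<le> b" "b \<le> c"
  shows "(LBINT r:{a..b}. f r) + (LBINT r:{b..c}. f r) = (LBINT r:{a..c}. f r)"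
  using assms by (simp add: loc_integrableD(3)[OF assms(1)] loc_integrableD(2)[OF assms(1)] Henstock_Kurzweil_Integration.integral_combine)

text \<open>Absolute continuity is encoded by its density, and differentiability is recovered almost
  everywhere. The restriction to \<open>s \<le> t\<close> matters: the set integral over a reversed
  interval is 0, not the negative of the oriented one.\<close>

definition primitive_of :: "(real \<Rightarrow> real) \<Rightarrow> (real \<Rightarrow> real) \<Rightarrow> bool" where
  "primitive_of F f \<longleftrightarrow> loc_integrable f \<and> (\<forall>s t. s \<le> t \<longrightarrow> F t - F s = (LBINT r:{s..t}. f r))"

lemma primitive_ofD:
  assumes "primitive_of F f"
  shows "loc_integrable f" "s \<le> t \<Longrightarrow> F t - F s = (LBINT r:{s..t}. f r)"
  using assms by (auto simp: primitive_of_def)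

lemma loc_integrable_primitive:
  assumes "loc_integrable f"
  obtains F where "primitive_of F f"
proof
  \<comment> \<open>At most one of the two integrals is nonzero, since a reversed interval is empty;
    their difference is the oriented integral from 0 to \<open>t\<close>.\<close>
  define F where "F = (\<lambda>t. (LBINT r:{0..t}. f r) - (LBINT r:{t..0}. f r))"
  note sp = loc_integrable_integral_split[OF assms]
  have z: "(LBINT r:{x..x}. f r) = 0" for x using sp[of x x x] by simp
  have e: "y < x \<Longrightarrow> (LBINT r:{x..y}. f r) = 0" for x y by (simp add: set_lebesgue_integral_def)
  have e0: "y \<le> x \<Longrightarrow> (LBINT r:{x..y}. f r) = 0" for x y
    using z[of x] e[of y x] by (cases "x = y") auto
  have "F t - F s = (LBINT r:{s..t}. f r)" if st: "s \<le> t" for s t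
  proof -
    consider "0 \<le> s" | "s \<le> 0" "0 \<le> t" | "t \<le> 0" by linarith
    then show ?thesis
    proof cases
      case 1 then show ?thesis using sp[of 0 s t] st e0[of 0 t] e0[of 0 s] by (simp add: F_def)
    next
      case 2 then show ?thesis using sp[of s 0 t] e0[of 0 t] e0[of s 0] by (simp add: F_def)
    next
      case 3 then show ?thesis using sp[of s t 0] st e0[of t 0] e0[of s 0] by (simp add: F_def)
    qed
  qed
  then show "primitive_of F f" using assms by (auto simp: primitive_of_def)
qed

lemma primitive_continuous:
  assumes "primitive_of F f"
  shows "continuous_on UNIV F"
proof -
  note li = primitive_ofD(1)[OF assms] and F = primitive_ofD(2)[OF assms]
  have "isCont F x" for x
  proof -
    have "continuous_on {x-1..x+1} (\<lambda>t. F (x-1) + integral {x-1..t} f)"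
      by (intro continuous_intros indefinite_integral_continuous_1 loc_integrableD(2)[OF li])
    then have "continuous_on {x-1..x+1} F"
      proof (rule continuous_on_eq)
      show "F (x - 1) + integral {x - 1..t} f = F t" if "t \<in> {x - 1..x + 1}" for t
        using that F[of "x-1" t] loc_integrableD(3)[OF li, of "x-1" t] by simp
    qed
    then show "isCont F x"
      by (rule continuous_on_interior) auto
  qed
  then show ?thesis by (simp add: continuous_at_imp_continuous_on)
qed

text \<open>This is Lebesgue differentiation. The averages in
  \<open>integrable_ccontinuous_explicit\<close> run over cubes with lower corner \<open>x\<close>,
  so in dimension one they are the quotients with positive increment.\<close>

lemma primitive_right_quotient:
  assumes "primitive_of F f"
  shows "AE x in lborel. ((\<lambda>h. (F (x + h) - F x) / h) \<longlongrightarrow> f x) (at_right 0)"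
proof -
  note li = primitive_ofD(1)[OF assms] and F = primitive_ofD(2)[OF assms]
  have "f integrable_on cbox a b" for a b
    using loc_integrableD(2)[OF li] by simp
  then obtain N where N: "negligible N"
    "\<And>x e. \<lbrakk>x \<notin> N; 0 < e\<rbrakk> \<Longrightarrow> \<exists>d>0. \<forall>h. 0 < h \<and> h < d \<longrightarrow>
       norm (integral (cbox x (x + h *\<^sub>R One)) f /\<^sub>R h ^ DIM(real) - f x) < e"
    using integrable_ccontinuous_explicit[of f] by metis
  have "AE x in lborel. x \<notin> N" by (rule negligible_imp_AE_lborel[OF N(1)])
  then show ?thesis
  proof eventually_elim
    case (elim x)
    show ?case
    proof (rule tendstoI)
      fix e :: real assume "0 < e"
      then obtain d where d: "d > 0" "\<And>h. 0 < h \<Longrightarrow> h < d \<Longrightarrow>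
          norm (integral (cbox x (x + h *\<^sub>R One)) f /\<^sub>R h ^ DIM(real) - f x) < e"
        using N(2)[OF elim] by blast
      show "\<forall>\<^sub>F h in at_right 0. dist ((F (x + h) - F x) / h) (f x) < e"
        unfolding eventually_at_right_field
      proof (intro exI[of _ d] conjI allI impI d(1))
        fix h :: real assume h: "0 < h" "h < d"
        have "F (x + h) - F x = integral {x..x+h} f"
          using F[of x "x+h"] h loc_integrableD(3)[OF li] by simp
        then show "dist ((F (x + h) - F x) / h) (f x) < e"
          using d(2)[OF h] by (simp add: dist_norm divide_inverse mult.commute)
      qed
    qed
  qed
qed

section \<open>Reflection of the line: from right-hand to two-sided derivatives\<close>

lemma AE_lborel_uminus:
  assumes "AE x::real in lborel. P x"
  shows "AE x in lborel. P (- x)"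
proof -
  have "AE x in distr lborel borel uminus. P x"
    using assms lborel_distr_uminus by metis
  then show ?thesis
    using AE_distrD[of uminus lborel borel P] by simp
qed

lemma LBINT_Icc_reflect: "(LBINT r:{a..b}. f (- r :: real)) = (LBINT r:{-b..-a}. f r :: real)"
proof -
  have "(LBINT r:{-b..-a}. f r) = (LBINT r. indicator {-b..-a} (- r) *\<^sub>R f (- r))"
    unfolding set_lebesgue_integral_def
    by (subst lborel_integral_real_affine[of "-1" _ 0]) auto
  also have "(\<lambda>r. indicator {-b..-a} (- r) *\<^sub>R f (- r)) = (\<lambda>r. indicator {a..b} r *\<^sub>R f (- r))"
    by (auto simp: indicator_def)
  finally show ?thesis by (simp add: set_lebesgue_integral_def)
qed

lemma loc_integrable_reflect:
  assumes "loc_integrable f"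
  shows "loc_integrable (\<lambda>x. f (- x))"
  unfolding loc_integrable_def
proof (intro allI)
  fix a b
  have "integrable lborel (\<lambda>r. indicator {-b..-a} r *\<^sub>R f r)"
    using loc_integrableD(1)[OF assms] by (simp add: set_integrable_def)
  then have "integrable lborel (\<lambda>r. indicator {-b..-a} (- r) *\<^sub>R f (- r))"
    using lborel_integrable_real_affine_iff[of "-1" "\<lambda>r. indicator {-b..-a} r *\<^sub>R f r" 0] by simp
  also have "(\<lambda>r. indicator {-b..-a} (- r) *\<^sub>R f (- r)) = (\<lambda>r. indicator {a..b} r *\<^sub>R f (- r))"
    by (auto simp: indicator_def)
  finally show "set_integrable lborel {a..b} (\<lambda>x. f (- x))" by (simp add: set_integrable_def)
qed

text \<open>The left-hand quotient of \<open>F\<close> at \<open>x\<close> is the right-hand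
  quotient of \<open>- F (- x)\<close> at the reflected point, and reflection preserves null
  sets.\<close>

theorem primitive_AE_has_derivative:
  assumes "primitive_of F f"
  shows "AE x in lborel. (F has_real_derivative f x) (at x)"
proof -
  note li = primitive_ofD(1)[OF assms] and F = primitive_ofD(2)[OF assms]
  define F' where "F' = (\<lambda>x. - F (- x))"
  have "F' t - F' s = (LBINT r:{s..t}. f (- r))" if "s \<le> t" for s t
    using F[of "-t" "-s"] that by (simp add: F'_def LBINT_Icc_reflect)
  then have "primitive_of F' (\<lambda>x. f (- x))"
    using loc_integrable_reflect li by (simp add: primitive_of_def)
  from primitive_right_quotient[OF this]
  have "AE x in lborel. ((\<lambda>h. (F' (x + h) - F' x) / h) \<longlongrightarrow> f (- x)) (at_right 0)" .
  from AE_lborel_uminus[OF this] primitive_right_quotient[OF assms]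
  show ?thesis
  proof eventually_elim
    case (elim x)
    have "((\<lambda>h. (F (x + h) - F x) / h) \<longlongrightarrow> f x) (at_left 0)"
    proof -
      have "((\<lambda>h. (F' (- x + - h) - F' (- x)) / (- h)) \<longlongrightarrow> f x) (at_left 0)"
        using elim(1) by (simp add: filterlim_at_left_to_right)
      then show ?thesis by (simp add: F'_def minus_divide_right[symmetric] diff_divide_distrib add.commute) 
    qed
    with elim(2) have "((\<lambda>h. (F (x + h) - F x) / h) \<longlongrightarrow> f x) (at 0)"
      by (simp add: filterlim_split_at)
    then show ?case by (simp add: DERIV_def)
  qed
qed

section \<open>Densities of dominated functions\<close>

lemma primitive_nn_integral:
  assumes "primitive_of M m" "\<And>x. 0 \<le> m x" "a \<le> b"
  shows "(\<integral>\<^sup>+x\<in>{a..b}. ennreal (m x) \<partial>lborel) = ennreal (M b - M a)"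
proof -
  have "(\<integral>\<^sup>+x\<in>{a..b}. ennreal (m x) \<partial>lborel) = (\<integral>\<^sup>+x. ennreal (indicator {a..b} x *\<^sub>R m x) \<partial>lborel)"
    by (intro nn_integral_cong) (auto simp: indicator_def)
  also have "\<dots> = ennreal (LBINT x:{a..b}. m x)"
    unfolding set_lebesgue_integral_def
    using loc_integrableD(1)[OF primitive_ofD(1)[OF assms(1)], of a b] assms(2)
    by (intro nn_integral_eq_integral) (auto simp: set_integrable_def indicator_def)
  finally show ?thesis using primitive_ofD(2)[OF assms(1,3)] by simp
qed

lemma emeasure_sum_measure:
  assumes "sets N1 = sets M" "sets N2 = sets M" "A \<in> sets M"
  shows "emeasure (measure_of (space M) (sets M) (\<lambda>A. emeasure N1 A + emeasure N2 A)) A = emeasure N1 A + emeasure N2 A"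
proof (rule emeasure_measure_of_sigma)
  show "sigma_algebra (space M) (sets M)" by (rule sets.sigma_algebra_axioms)
  show "positive (sets M) (\<lambda>A. emeasure N1 A + emeasure N2 A)" by (simp add: positive_def)
  show "countably_additive (sets M) (\<lambda>A. emeasure N1 A + emeasure N2 A)"
    using assms by (auto simp: countably_additive_def suminf_add[symmetric] suminf_emeasure)
qed (use assms in auto)

text \<open>The Stieltjes measure of \<open>G\<close> is dominated by \<open>m\<close> times Lebesgue measure because the Stieltjes
  measures of \<open>G\<close> and \<open>M - G\<close> add up to the latter.\<close>

lemma dominated_mono_density:
  fixes G M :: "real \<Rightarrow> real"
  assumes M: "primitive_of M m" and m0: "\<And>x. 0 \<le> m x"
    and G: "\<And>s t. s \<le> t \<Longrightarrow> G s \<le> G t" and GM: "\<And>s t. s \<le> t \<Longrightarrow> G t - G s \<le> M t - M s"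
  obtains h where "primitive_of G h"
proof -
  define H where "H = (\<lambda>x. M x - G x)"
  have Hm: "s \<le> t \<Longrightarrow> H s \<le> H t" for s t using GM[of s t] by (simp add: H_def)
  have Mc: "continuous_on UNIV M" by (rule primitive_continuous[OF M])
  \<comment> \<open>Continuity excludes atoms, so the Stieltjes measure of a closed interval is the
    difference of the endpoint values.\<close>
  have "isCont G x" for x
  proof -
    have Mx: "isCont M x" using Mc by (simp add: continuous_on_eq_continuous_at)
    have "((\<lambda>y. \<bar>M y - M x\<bar>) \<longlongrightarrow> \<bar>M x - M x\<bar>) (at x)"
      by (intro tendsto_intros Mx[unfolded isCont_def])
    then have "((\<lambda>y. \<bar>M y - M x\<bar>) \<longlongrightarrow> 0) (at x)" by simp
    then have "((\<lambda>y. G y - G x) \<longlongrightarrow> 0) (at x)"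
    proof (rule Lim_null_comparison[rotated])
      show "\<forall>\<^sub>F y in at x. norm (G y - G x) \<le> \<bar>M y - M x\<bar>"
      proof (rule always_eventually, rule allI)
        fix y show "norm (G y - G x) \<le> \<bar>M y - M x\<bar>"
          using G[of x y] GM[of x y] G[of y x] GM[of y x] by (cases "x \<le> y") auto
      qed
    qed
    then show ?thesis by (simp add: isCont_def LIM_zero_iff)
  qed
  then have Gc: "continuous_on UNIV G" by (simp add: continuous_at_imp_continuous_on)
  have Hc: "continuous_on UNIV H" unfolding H_def by (intro continuous_intros Gc Mc)
  have rc: "continuous (at_right a) F" if "continuous_on UNIV F" for F :: "real \<Rightarrow> real" and a
    using that by (simp add: continuous_on_eq_continuous_at continuous_at_imp_continuous_within)
  define \<mu> where "\<mu> = interval_measure G"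
  define \<nu> where "\<nu> = interval_measure H"
  define S where "S = measure_of UNIV (sets borel) (\<lambda>A. emeasure \<mu> A + emeasure \<nu> A)"
  have s\<mu>: "sets \<mu> = sets borel" "sets \<nu> = sets borel" by (simp_all add: \<mu>_def \<nu>_def)
  have sS: "sets S = sets borel" unfolding S_def
    using sets.sigma_sets_eq[of "borel::real measure"] by simp
  have eS: "emeasure S A = emeasure \<mu> A + emeasure \<nu> A" if "A \<in> sets borel" for A
    unfolding S_def using emeasure_sum_measure[of \<mu> borel \<nu> A] s\<mu> that by simp
  have mb: "m \<in> borel_measurable borel"
    by (rule loc_integrable_measurable[OF primitive_ofD(1)[OF M]])
  have "S = density lborel (\<lambda>x. ennreal (m x))"
  proof (rule measure_eqI_generator_eq)
    let ?E = "range (\<lambda>(a, b). {a..b} :: real set)"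
    show "Int_stable ?E" by (auto simp: Int_stable_def)
    show "sets S = sigma_sets UNIV ?E" "sets (density lborel (\<lambda>x. ennreal (m x))) = sigma_sets UNIV ?E"
      by (simp_all add: sS borel_eq_atLeastAtMost sets_measure_of_conv)
    show "range (\<lambda>n::nat. {- real n..real n}) \<subseteq> ?E" by auto
    show "(\<Union>n::nat. {- real n..real n}) = UNIV"
    proof safe
      fix x :: real
      obtain n where "\<bar>x\<bar> \<le> real n" using real_arch_simple by blast
      then show "x \<in> (\<Union>n::nat. {- real n..real n})" by (auto simp: abs_le_iff intro!: exI[of _ n])
    qed auto
    have eqS: "emeasure S {a..b} = ennreal (if a \<le> b then M b - M a else 0)" for a b
      using G[of a b] Hm[of a b] G[of a b]
      by (auto simp: eS \<mu>_def \<nu>_def emeasure_interval_measure_Icc G Hm Gc Hc simp flip: ennreal_plus) (simp add: H_def)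
    show "emeasure S {- real n..real n} \<noteq> \<infinity>" for n by (simp add: eqS)
    show "emeasure S X = emeasure (density lborel (\<lambda>x. ennreal (m x))) X" if "X \<in> ?E" for X
    proof -
      from that obtain a b where X: "X = {a..b}" by auto
      have "emeasure (density lborel (\<lambda>x. ennreal (m x))) X = (\<integral>\<^sup>+x\<in>{a..b}. ennreal (m x) \<partial>lborel)"
        using mb by (simp add: X emeasure_density)
      also have "\<dots> = ennreal (if a \<le> b then M b - M a else 0)"
        using primitive_nn_integral[OF M m0, of a b] by simp
      finally show ?thesis by (simp add: X eqS)
    qed
  qed auto
  then have S: "emeasure S A = emeasure (density lborel (\<lambda>x. ennreal (m x))) A" for A by simp
  have "absolutely_continuous lborel \<mu>"
    unfolding absolutely_continuous_def
  proof
    fix A assume A: "A \<in> null_sets (lborel :: real measure)"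
    then have Ab: "A \<in> sets borel" by auto
    have "A \<in> null_sets (density lborel (\<lambda>x. ennreal (m x)))"
      using absolutely_continuousI_density[of "\<lambda>x. ennreal (m x)" lborel] mb A
      by (auto simp: absolutely_continuous_def)
    then have "emeasure S A = 0" by (simp add: S null_setsD1)
    then show "A \<in> null_sets \<mu>" using eS[OF Ab] Ab by (simp add: null_sets_def s\<mu>)
  qed
  with sigma_finite_measure.Radon_Nikodym[OF sigma_finite_lborel this] s\<mu>
  obtain f where f[measurable]: "f \<in> borel_measurable lborel" and d: "density lborel f = \<mu>" by auto
  have fI: "(\<integral>\<^sup>+x\<in>{a..b}. f x \<partial>lborel) = ennreal (G b - G a)" if "a \<le> b" for a b
  proof -
    have "(\<integral>\<^sup>+x\<in>{a..b}. f x \<partial>lborel) = emeasure (density lborel f) {a..b}" by (simp add: emeasure_density)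
    then show ?thesis unfolding d using that by (simp add: \<mu>_def emeasure_interval_measure_Icc G Gc)
  qed
  \<comment> \<open>Since \<open>enn2real\<close> sends infinity to 0, the passage to a real density
    loses no mass only if \<open>f\<close> is finite almost everywhere; its integrals over bounded
    intervals are finite.\<close>
  have fin: "AE x in lborel. f x < \<infinity>"
  proof -
    have "AE x in lborel. f x * indicator {-real n..real n} x \<noteq> \<infinity>" for n :: nat
      by (rule nn_integral_noteq_infinite) (use fI[of "-real n" "real n"] in auto)
    then have "AE x in lborel. \<forall>n::nat. f x * indicator {-real n..real n} x \<noteq> \<infinity>"
      by (simp add: AE_all_countable)
    then show ?thesis
    proof eventually_elim
      case (elim x)
      obtain n where "\<bar>x\<bar> \<le> real n" using real_arch_simple by blast
      then have "x \<in> {-real n..real n}" by (auto simp: abs_le_iff)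
      then show ?case using elim[rule_format, of n] by (simp add: less_top)
    qed
  qed
  define h where "h = (\<lambda>x. enn2real (f x))"
  have hI: "has_bochner_integral lborel (\<lambda>x. indicator {a..b} x *\<^sub>R h x) (G b - G a)" if "a \<le> b" for a b
  proof (rule has_bochner_integral_nn_integral)
    have "(\<integral>\<^sup>+x. ennreal (indicator {a..b} x *\<^sub>R h x) \<partial>lborel) = (\<integral>\<^sup>+x\<in>{a..b}. f x \<partial>lborel)"
      by (rule nn_integral_cong_AE, use fin in eventually_elim) (auto simp: h_def indicator_def)
    then show "(\<integral>\<^sup>+x. ennreal (indicator {a..b} x *\<^sub>R h x) \<partial>lborel) = ennreal (G b - G a)"
      using fI[OF that] by simp
  qed (use G[OF that] in \<open>auto simp: h_def indicator_def\<close>)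
  have "primitive_of G h"
    unfolding primitive_of_def loc_integrable_def
  proof (intro conjI allI impI)
    fix a b :: real
    show "set_integrable lborel {a..b} h"
      using hI[of a b] by (cases "a \<le> b") (auto simp: set_integrable_def has_bochner_integral_iff)
    show "G b - G a = (LBINT r:{a..b}. h r)" if "a \<le> b"
      using hI[OF that] by (simp add: set_lebesgue_integral_def has_bochner_integral_iff)
  qed
  then show thesis by (rule that)
qed

lemma primitive_of_diff:
  assumes "primitive_of F f" "primitive_of G g"
  shows "primitive_of (\<lambda>x. F x - G x) (\<lambda>x. f x - g x)"
  using assms unfolding primitive_of_def loc_integrable_def
  by (auto simp: algebra_simps)

text \<open>\<open>F\<close> need not be monotone, but \<open>F + M\<close> is, with increments at
  most twice those of \<open>M\<close>. The monotone case applies to it, and the density of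
  \<open>M\<close> is subtracted afterwards.\<close>

lemma dominated_density:
  fixes F M :: "real \<Rightarrow> real"
  assumes M: "primitive_of M m" and m0: "\<And>x. 0 \<le> m x"
    and F: "\<And>s t. s \<le> t \<Longrightarrow> \<bar>F t - F s\<bar> \<le> M t - M s"
  obtains h where "primitive_of F h"
proof -
  have M2: "primitive_of (\<lambda>x. 2 * M x) (\<lambda>x. 2 * m x)"
    using M unfolding primitive_of_def loc_integrable_def by (auto simp flip: right_diff_distrib)
  obtain h where "primitive_of (\<lambda>x. F x + M x) h"
  proof (rule dominated_mono_density[OF M2])
    fix s t :: real assume "s \<le> t"
    from F[OF this] show "F s + M s \<le> F t + M t" "F t + M t - (F s + M s) \<le> 2 * M t - 2 * M s" by auto
  qed (use m0 in auto)
  from primitive_of_diff[OF this M] have "primitive_of F (\<lambda>x. h x - m x)" by simp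
  then show thesis by (rule that)
qed

section \<open>The metric derivative of an absolutely continuous curve\<close>

lemma rational_sequence_tendsto:
  fixes s :: real
  obtains q :: "nat \<Rightarrow> real" where "\<And>n. q n \<in> \<rat>" "q \<longlonglongrightarrow> s"
proof -
  have "s \<in> closure \<rat>" by (simp add: Rats_closure_real)
  then show thesis using that unfolding closure_sequential by blast
qed

lemma has_derivative_abs_le:
  fixes F M :: "real \<Rightarrow> real"
  assumes F: "(F has_real_derivative a) (at t)" and M: "(M has_real_derivative b) (at t)"
    and le: "\<And>s. \<bar>F s - F t\<bar> \<le> \<bar>M s - M t\<bar>"
  shows "\<bar>a\<bar> \<le> \<bar>b\<bar>"
proof (rule tendsto_le)
  show "((\<lambda>s. \<bar>(F s - F t) / (s - t)\<bar>) \<longlongrightarrow> \<bar>a\<bar>) (at t)"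
    using F by (intro tendsto_rabs) (simp add: has_field_derivative_iff)
  show "((\<lambda>s. \<bar>(M s - M t) / (s - t)\<bar>) \<longlongrightarrow> \<bar>b\<bar>) (at t)"
    using M by (intro tendsto_rabs) (simp add: has_field_derivative_iff)
  show "\<forall>\<^sub>F s in at t. \<bar>(F s - F t) / (s - t)\<bar> \<le> \<bar>(M s - M t) / (s - t)\<bar>"
    using le by (intro always_eventually allI) (simp add: abs_divide divide_right_mono)
qed simp

text \<open>The speed is the supremum over rational \<open>q\<close> of the absolute derivatives of
  \<open>t \<mapsto> d(v(t), v(q))\<close>. By the reverse triangle inequality each of them bounds
  the metric quotient from below. The upper bound comes from differentiating the primitive
  \<open>N\<close> of the supremum, once \<open>d(v(s), v(t)) \<le> N(t) - N(s)\<close> is known.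
  Countably many \<open>q\<close> keep the supremum measurable and the exceptional set null.\<close>

theorem dominated_curve_metric_derivative:
  fixes v :: "real \<Rightarrow> 'a::metric_space"
  assumes M: "primitive_of M m" and m0: "\<And>x. 0 \<le> m x"
    and v: "\<And>s t. s \<le> t \<Longrightarrow> dist (v s) (v t) \<le> M t - M s"
  obtains N n where "primitive_of N n" "\<And>t. 0 \<le> n t" "\<And>t. n t \<le> m t"
    "AE t in lborel. ((\<lambda>s. dist (v s) (v t) / \<bar>s - t\<bar>) \<longlongrightarrow> n t) (at t)"
    "\<And>s t. s \<le> t \<Longrightarrow> dist (v s) (v t) \<le> N t - N s"
proof -
  have vM: "dist (v s) (v t) \<le> \<bar>M s - M t\<bar>" for s t
    using v[of s t] v[of t s] by (cases "s \<le> t") (auto simp: dist_commute)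
  have Mc: "isCont M x" for x
    using primitive_continuous[OF M] by (simp add: continuous_on_eq_continuous_at)
  have dM: "\<bar>dist (v t) (v q) - dist (v s) (v q)\<bar> \<le> \<bar>M s - M t\<bar>" for s t q
    using vM[of s t] dist_triangle[of "v t" "v q" "v s"] dist_triangle[of "v s" "v q" "v t"]
    by (simp add: dist_commute abs_le_iff)
  have "\<exists>h. primitive_of (\<lambda>t. dist (v t) (v q)) h" for q
  proof -
    obtain h where "primitive_of (\<lambda>t. dist (v t) (v q)) h"
    proof (rule dominated_density[OF M m0])
      fix s t :: real assume "s \<le> t"
      then have "0 \<le> M t - M s" using v zero_le_dist order_trans by blast
      with dM[of t q s] show "\<bar>dist (v t) (v q) - dist (v s) (v q)\<bar> \<le> M t - M s" by simp
    qed
    then show ?thesis by blast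
  qed
  then obtain h where h: "\<And>q. primitive_of (\<lambda>t. dist (v t) (v q)) (h q)" by metis
  have hb: "h q \<in> borel_measurable borel" for q
    by (rule loc_integrable_measurable[OF primitive_ofD(1)[OF h]])
  have mb: "m \<in> borel_measurable borel"
    by (rule loc_integrable_measurable[OF primitive_ofD(1)[OF M]])
  \<comment> \<open>The cap \<open>m t\<close> makes the supremum finite at every \<open>t\<close>,
    also where the derivatives fail to exist. Almost everywhere it is inactive, because
    \<open>\<bar>h q t\<bar> \<le> m t\<close> there.\<close>
  define n where "n = (\<lambda>t. SUP q\<in>\<rat>. min \<bar>h q t\<bar> (m t))"
  have bdd: "bdd_above ((\<lambda>q. min \<bar>h q t\<bar> (m t)) ` \<rat>)" for t
    by (rule bdd_aboveI2[of _ _ "m t"]) simp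
  have Qne: "(\<rat> :: real set) \<noteq> {}" using Rats_0 by blast
  have nb: "n \<in> borel_measurable borel"
    unfolding n_def by (rule borel_measurable_cSUP) (use bdd hb mb countable_rat in auto)
  have nm: "n t \<le> m t" for t
    unfolding n_def by (rule cSUP_least[OF Qne]) simp
  have n0: "0 \<le> n t" for t
    unfolding n_def using m0 by (intro cSUP_upper2[OF bdd Rats_0]) simp
  have nli: "loc_integrable n"
    by (rule loc_integrable_bound[OF primitive_ofD(1)[OF M] nb]) (use n0 nm m0 in auto)
  then obtain N where N: "primitive_of N n" by (rule loc_integrable_primitive)

  have AEh: "AE t in lborel. \<forall>q\<in>\<rat>. ((\<lambda>t. dist (v t) (v q)) has_real_derivative h q t) (at t)"
    by (subst AE_ball_countable[OF countable_rat]) (auto intro: primitive_AE_has_derivative[OF h])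
  have AEn: "AE t in lborel. \<forall>q\<in>\<rat>. \<bar>h q t\<bar> \<le> m t"
    using AEh primitive_AE_has_derivative[OF M]
  proof eventually_elim
    case (elim t)
    show ?case
    proof
      fix q :: real assume "q \<in> \<rat>"
      with elim(1) have "((\<lambda>t. dist (v t) (v q)) has_real_derivative h q t) (at t)" by blast
      moreover have "\<bar>dist (v s) (v q) - dist (v t) (v q)\<bar> \<le> \<bar>M s - M t\<bar>" for s
        using dM by (metis abs_minus_commute)
      ultimately have "\<bar>h q t\<bar> \<le> \<bar>m t\<bar>"
        by (intro has_derivative_abs_le[OF _ elim(2)])
      with m0[of t]
      show "\<bar>h q t\<bar> \<le> m t" by simp
    qed
  qed
  then have AEle: "AE t in lborel. \<forall>q\<in>\<rat>. \<bar>h q t\<bar> \<le> n t"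
  proof eventually_elim
    case (elim t)
    show ?case
    proof
      fix q :: real assume q: "q \<in> \<rat>"
      have "min \<bar>h q t\<bar> (m t) \<le> n t" unfolding n_def by (rule cSUP_upper[OF q bdd])
      with elim q show "\<bar>h q t\<bar> \<le> n t" by auto
    qed
  qed
  have vN: "dist (v s) (v t) \<le> N t - N s" if st: "s \<le> t" for s t
  proof -
    have *: "dist (v t) (v q) - dist (v s) (v q) \<le> N t - N s" if q: "q \<in> \<rat>" for q
    proof -
      have "dist (v t) (v q) - dist (v s) (v q) = (LBINT r:{s..t}. h q r)"
        using primitive_ofD(2)[OF h st] .
      also have "\<dots> \<le> (LBINT r:{s..t}. n r)"
        unfolding set_lebesgue_integral_def
      proof (rule integral_mono_AE)
        show "integrable lborel (\<lambda>r. indicator {s..t} r *\<^sub>R h q r)" "integrable lborel (\<lambda>r. indicator {s..t} r *\<^sub>R n r)"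
          using loc_integrableD(1)[OF primitive_ofD(1)[OF h]] loc_integrableD(1)[OF nli] by (auto simp: set_integrable_def)
        show "AE r in lborel. indicator {s..t} r *\<^sub>R h q r \<le> indicator {s..t} r *\<^sub>R n r"
          using AEle by eventually_elim (use q in \<open>force simp: indicator_def\<close>)
      qed
      also have "\<dots> = N t - N s" using primitive_ofD(2)[OF N st] by simp
      finally show ?thesis .
    qed
    \<comment> \<open>As \<open>q\<close> tends to \<open>s\<close>, the difference
      \<open>d(v(t), v(q)) - d(v(s), v(q))\<close> tends to the full distance
      \<open>d(v(t), v(s))\<close>.\<close>
    obtain q :: "nat \<Rightarrow> real" where q: "\<And>k. q k \<in> \<rat>" "q \<longlonglongrightarrow> s" using rational_sequence_tendsto[of s] by blast
    have "(\<lambda>k. \<bar>M (q k) - M s\<bar>) \<longlonglongrightarrow> \<bar>M s - M s\<bar>"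
      by (intro tendsto_intros isCont_tendsto_compose[OF Mc q(2)])
    then have "(\<lambda>k. \<bar>M (q k) - M s\<bar>) \<longlonglongrightarrow> 0" by simp
    then have "(\<lambda>k. dist (v (q k)) (v s)) \<longlonglongrightarrow> 0"
      by (rule Lim_null_comparison[rotated]) (use vM in \<open>auto\<close>)
    then have vq: "(\<lambda>k. v (q k)) \<longlonglongrightarrow> v s" by (rule tendsto_dist_iff[THEN iffD2])
    have "(\<lambda>k. dist (v t) (v (q k)) - dist (v s) (v (q k))) \<longlonglongrightarrow> dist (v t) (v s) - dist (v s) (v s)"
      by (intro tendsto_intros vq)
    then have "dist (v t) (v s) - dist (v s) (v s) \<le> N t - N s"
      by (rule LIMSEQ_le_const2) (use * q(1) in blast)
    then show ?thesis by (simp add: dist_commute)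
  qed
  have vN': "dist (v s) (v t) \<le> \<bar>N s - N t\<bar>" for s t
    using vN[of s t] vN[of t s] by (cases "s \<le> t") (auto simp: dist_commute)
  have "AE t in lborel. ((\<lambda>s. dist (v s) (v t) / \<bar>s - t\<bar>) \<longlongrightarrow> n t) (at t)"
    using AEh primitive_AE_has_derivative[OF N]
  proof eventually_elim
    case (elim t)
    have up: "((\<lambda>s. \<bar>(N s - N t) / (s - t)\<bar>) \<longlongrightarrow> \<bar>n t\<bar>) (at t)"
      using elim(2) by (intro tendsto_rabs) (simp add: has_field_derivative_iff)
    show ?case
    proof (rule order_tendstoI)
      fix c assume "c < n t"
      then obtain q where q: "q \<in> \<rat>" "c < min \<bar>h q t\<bar> (m t)"
        unfolding n_def using less_cSUP_iff[OF Qne bdd] by blast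
      have lo: "((\<lambda>s. \<bar>(dist (v s) (v q) - dist (v t) (v q)) / (s - t)\<bar>) \<longlongrightarrow> \<bar>h q t\<bar>) (at t)"
        using elim(1) q(1) by (intro tendsto_rabs) (simp add: has_field_derivative_iff)
      have "\<forall>\<^sub>F s in at t. c < \<bar>(dist (v s) (v q) - dist (v t) (v q)) / (s - t)\<bar>"
        by (rule order_tendstoD(1)[OF lo]) (use q in simp)
      then show "\<forall>\<^sub>F s in at t. c < dist (v s) (v t) / \<bar>s - t\<bar>"
      proof eventually_elim
        case (elim s)
        have "\<bar>dist (v s) (v q) - dist (v t) (v q)\<bar> \<le> dist (v s) (v t)"
          using dist_triangle[of "v t" "v q" "v s"] dist_triangle[of "v s" "v q" "v t"]
          by (simp add: dist_commute abs_le_iff)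
        then have "\<bar>(dist (v s) (v q) - dist (v t) (v q)) / (s - t)\<bar> \<le> dist (v s) (v t) / \<bar>s - t\<bar>"
          by (simp add: abs_divide divide_right_mono)
        with elim show ?case by simp
      qed
    next
      fix c assume "n t < c"
      then have "\<forall>\<^sub>F s in at t. \<bar>(N s - N t) / (s - t)\<bar> < c"
        using n0[of t] by (intro order_tendstoD(2)[OF up]) simp
      then show "\<forall>\<^sub>F s in at t. dist (v s) (v t) / \<bar>s - t\<bar> < c"
      proof eventually_elim
        case (elim s)
        have "dist (v s) (v t) / \<bar>s - t\<bar> \<le> \<bar>(N s - N t) / (s - t)\<bar>"
          using vN'[of s t] by (simp add: abs_divide divide_right_mono)
        with elim show ?case by simp
      qed
    qed
  qed
  from that[OF N n0 nm this vN] show thesis by blast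
qed

text \<open>\<open>v (max t \<delta>)\<close> is defined and dominated on the whole line, and agrees with \<open>v\<close> on \<open>[\<delta>, \<infinity>)\<close>.\<close>

lemma AC_loc_metric_derivative:
  fixes v :: "real \<Rightarrow> 'a::metric_space"
  assumes "AC_loc 0 \<infinity> v"
  obtains m where "loc_integrable m" "\<And>x. 0 \<le> m x" "continuous_on {0<..} v"
    "AE t in lborel. 0 < t \<longrightarrow> 0 \<le> metric_derivative v t \<and> metric_derivative v t \<le> m t"
    "\<And>s t. 0 < s \<Longrightarrow> s \<le> t \<Longrightarrow>
       ennreal (dist (v s) (v t)) \<le> (\<integral>\<^sup>+r\<in>{s..t}. ennreal (metric_derivative v r) \<partial>lborel)"
proof -
  from assms obtain m where m: "\<And>T::real. 0 < T \<Longrightarrow> set_integrable lborel (einterval 0 T) m"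
    "\<And>s t. 0 < s \<Longrightarrow> s \<le> t \<Longrightarrow> dist (v s) (v t) \<le> (LBINT r:{s..t}. m r)"
    by (auto simp: AC_loc_def zero_ereal_def)
  \<comment> \<open>Extension by 0 to negative times stays locally integrable because
    \<open>AC_loc\<close> grants integrability of \<open>m\<close> down to time 0.\<close>
  define k where "k = (\<lambda>x. indicator {0<..} x * \<bar>m x\<bar>)"
  have k0: "0 \<le> k x" for x by (simp add: k_def)
  have "loc_integrable k"
    unfolding loc_integrable_def
  proof (intro allI)
    fix a b :: real
    \<comment> \<open>\<open>T\<close> is positive and exceeds \<open>b\<close>, so
      \<open>(0, T)\<close> covers the part of \<open>[a, b]\<close> on which \<open>k\<close> can
      be nonzero.\<close>
    define T where "T = max 1 (b + 1)"
    have "set_integrable lborel (einterval 0 T) (\<lambda>x. \<bar>m x\<bar>)"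
      by (rule set_integrable_abs[OF m(1)]) (simp add: T_def max_def)
    then have "set_integrable lborel ({a..b} \<inter> einterval 0 T) (\<lambda>x. \<bar>m x\<bar>)"
      by (rule set_integrable_subset) auto
    also have "(\<lambda>x. indicator ({a..b} \<inter> einterval 0 T) x *\<^sub>R \<bar>m x\<bar>) = (\<lambda>x. indicator {a..b} x *\<^sub>R k x)"
      by (auto simp: k_def indicator_def einterval_iff T_def zero_ereal_def fun_eq_iff)
    then have "set_integrable lborel ({a..b} \<inter> einterval 0 T) (\<lambda>x. \<bar>m x\<bar>) = set_integrable lborel {a..b} k"
      by (simp add: set_integrable_def)
    finally show "set_integrable lborel {a..b} k" .
  qed
  then obtain K where K: "primitive_of K k" by (rule loc_integrable_primitive)
  have Kmono: "K s \<le> K t" if "s \<le> t" for s t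
  proof -
    have "0 \<le> (LBINT r:{s..t}. k r)"
      unfolding set_lebesgue_integral_def by (rule integral_nonneg_AE) (simp add: k0)
    then show ?thesis using primitive_ofD(2)[OF K that] by simp
  qed
  have vK: "dist (v s) (v t) \<le> K t - K s" if "0 < s" "s \<le> t" for s t
  proof -
    have "dist (v s) (v t) \<le> (LBINT r:{s..t}. m r)" by (rule m(2)[OF that])
    also have "\<dots> \<le> (LBINT r:{s..t}. k r)"
    proof (rule set_integral_mono)
      show "set_integrable lborel {s..t} m"
        by (rule set_integrable_subset[OF m(1)[of "t + 1"]])
           (use that in \<open>auto simp: einterval_iff zero_ereal_def\<close>)
      show "set_integrable lborel {s..t} k" by (rule loc_integrableD(1)[OF primitive_ofD(1)[OF K]])
    qed (use that in \<open>auto simp: k_def\<close>)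
    finally show ?thesis using primitive_ofD(2)[OF K that(2)] by simp
  qed
  have local: "\<exists>N n. primitive_of N n \<and> (\<forall>t. 0 \<le> n t \<and> n t \<le> k t) \<and>
      (AE t in lborel. \<delta> < t \<longrightarrow> metric_derivative v t = n t) \<and>
      (\<forall>s t. \<delta> \<le> s \<longrightarrow> s \<le> t \<longrightarrow> dist (v s) (v t) \<le> N t - N s)" if \<delta>: "0 < \<delta>" for \<delta>
  proof -
    define u where "u = (\<lambda>t. v (max t \<delta>))"
    have uK: "dist (u s) (u t) \<le> K t - K s" if st: "s \<le> t" for s t
    proof -
      consider "t \<le> \<delta>" | "s \<le> \<delta>" "\<delta> \<le> t" | "\<delta> \<le> s" by linarith
      then show ?thesis
      proof cases
        case 1 then show ?thesis using st Kmono[OF st] by (simp add: u_def max_def)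
      next
        case 2 then show ?thesis using vK[OF \<delta>, of t] Kmono[OF 2(1)] by (simp add: u_def max_def)
      next
        case 3 with st have "max s \<delta> = s" "max t \<delta> = t" by auto
        with 3 show ?thesis using vK[of s t] st \<delta> by (simp add: u_def)
      qed
    qed
    obtain N n where N: "primitive_of N n" "\<And>t. 0 \<le> n t" "\<And>t. n t \<le> k t"
      "AE t in lborel. ((\<lambda>s. dist (u s) (u t) / \<bar>s - t\<bar>) \<longlongrightarrow> n t) (at t)"
      "\<And>s t. s \<le> t \<Longrightarrow> dist (u s) (u t) \<le> N t - N s"
    proof (rule dominated_curve_metric_derivative[of K k u, OF K k0])
      show "dist (u s) (u t) \<le> K t - K s" if "s \<le> t" for s t by (rule uK[OF that])
    qed (rule that)
    have "AE t in lborel. \<delta> < t \<longrightarrow> metric_derivative v t = n t"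
      using N(4)
    proof (eventually_elim, intro impI)
      fix t assume elim: "((\<lambda>s. dist (u s) (u t) / \<bar>s - t\<bar>) \<longlongrightarrow> n t) (at t)" and t: "\<delta> < t"
      have "\<forall>\<^sub>F s in at t. \<delta> < s"
        using order_tendstoD(1)[OF tendsto_ident_at t] .
      then have "\<forall>\<^sub>F s in at t. dist (u s) (u t) / \<bar>s - t\<bar> = dist (v s) (v t) / \<bar>s - t\<bar>"
        by eventually_elim (use t in \<open>simp add: u_def max_def\<close>)
      with elim have "((\<lambda>s. dist (v s) (v t) / \<bar>s - t\<bar>) \<longlongrightarrow> n t) (at t)"
        by (rule Lim_transform_eventually)
      then show "metric_derivative v t = n t" unfolding metric_derivative_def by (intro tendsto_Lim) auto
    qed
    moreover have "dist (v s) (v t) \<le> N t - N s" if "\<delta> \<le> s" "s \<le> t" for s t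
    proof -
      have "max s \<delta> = s" "max t \<delta> = t" using that by auto
      then show ?thesis using N(5)[OF that(2)] by (simp add: u_def)
    qed
    ultimately show ?thesis using N(1-3) by blast
  qed
  show thesis
  proof (rule that)
    show "loc_integrable k" by (rule primitive_ofD(1)[OF K])
    show "0 \<le> k x" for x by (rule k0)
    have "isCont v x" if "0 < x" for x
    proof -
      have "isCont K x"
        using primitive_continuous[OF K] by (simp add: continuous_on_eq_continuous_at)
      then have "((\<lambda>y. \<bar>K y - K x\<bar>) \<longlongrightarrow> \<bar>K x - K x\<bar>) (at x)"
        unfolding isCont_def by (intro tendsto_intros)
      then have "((\<lambda>y. \<bar>K y - K x\<bar>) \<longlongrightarrow> 0) (at x)" by simp
      then have "((\<lambda>y. dist (v y) (v x)) \<longlongrightarrow> 0) (at x)"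
      proof (rule Lim_null_comparison[rotated])
        have "\<forall>\<^sub>F y in at x. 0 < y" using order_tendstoD(1)[OF tendsto_ident_at that] .
        then show "\<forall>\<^sub>F y in at x. norm (dist (v y) (v x)) \<le> \<bar>K y - K x\<bar>"
        proof eventually_elim
          case (elim y)
          then show ?case using vK[of x y] vK[of y x] that by (cases "x \<le> y") (auto simp: dist_commute)
        qed
      qed
      then show ?thesis unfolding isCont_def by (rule tendsto_dist_iff[THEN iffD2])
    qed
    then show "continuous_on {0<..} v" by (simp add: continuous_at_imp_continuous_on)
    \<comment> \<open>The density \<open>n\<close> depends on the cut-off \<open>\<delta>\<close>,
      but its bound \<open>k\<close> does not. Countably many cut-offs tending to 0 reach all
      positive times outside one null set.\<close>
    have "AE t in lborel. 1 / real (Suc j) < t \<longrightarrow> 0 \<le> metric_derivative v t \<and> metric_derivative v t \<le> k t" for j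
    proof -
      obtain N n where "\<forall>t. 0 \<le> n t \<and> n t \<le> k t" and
        A: "AE t in lborel. 1 / real (Suc j) < t \<longrightarrow> metric_derivative v t = n t"
        using local[of "1 / real (Suc j)"] by auto
      from A show ?thesis by eventually_elim (use \<open>\<forall>t. 0 \<le> n t \<and> n t \<le> k t\<close> in auto)
    qed
    then have "AE t in lborel. \<forall>j. 1 / real (Suc j) < t \<longrightarrow> 0 \<le> metric_derivative v t \<and> metric_derivative v t \<le> k t"
      by (subst AE_all_countable) blast
    then show "AE t in lborel. 0 < t \<longrightarrow> 0 \<le> metric_derivative v t \<and> metric_derivative v t \<le> k t"
    proof (eventually_elim, intro impI)
      fix t :: real
      assume *: "\<forall>j. 1 / real (Suc j) < t \<longrightarrow> 0 \<le> metric_derivative v t \<and> metric_derivative v t \<le> k t" and t: "0 < t"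
      obtain j where "1 / real (Suc j) < t" using t nat_approx_posE by blast
      then show "0 \<le> metric_derivative v t \<and> metric_derivative v t \<le> k t" using * by blast
    qed
    fix s t :: real assume st: "0 < s" "s \<le> t"
    from local[OF st(1)] obtain N n where N: "primitive_of N n" "\<And>t. 0 \<le> n t"
      and A: "AE r in lborel. s < r \<longrightarrow> metric_derivative v r = n r"
      and d: "dist (v s) (v t) \<le> N t - N s" using st by fastforce
    have "ennreal (dist (v s) (v t)) \<le> ennreal (N t - N s)" using d by (rule ennreal_leI)
    also have "\<dots> = (\<integral>\<^sup>+r\<in>{s..t}. ennreal (n r) \<partial>lborel)"
      using primitive_nn_integral[OF N st(2)] by simp
    \<comment> \<open>The cut-off is \<open>s\<close> itself, so the speed is identified only for
      \<open>r > s\<close>; the endpoint is a null set.\<close>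
    also have "\<dots> = (\<integral>\<^sup>+r\<in>{s..t}. ennreal (metric_derivative v r) \<partial>lborel)"
      by (rule nn_integral_cong_AE, use A AE_lborel_singleton[of s] in eventually_elim)
         (auto simp: indicator_def)
    finally show "ennreal (dist (v s) (v t)) \<le> (\<integral>\<^sup>+r\<in>{s..t}. ennreal (metric_derivative v r) \<partial>lborel)" .
  qed
qed

section \<open>Continuous functions with a locally integrable weak derivative\<close>

text \<open>The quadratic spline \<open>smooth_step\<close> rises from \<open>0\<close> to \<open>1\<close> on \<open>[0, 2]\<close>. Differences of two
  rescaled copies, starting at \<open>a\<close> and \<open>b\<close>, are the \<open>C\<^sup>1\<close> test functions that approximate the
  indicator of \<open>(a, b]\<close>.\<close>

definition smooth_step :: "real \<Rightarrow> real" where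
  "smooth_step y = ((max 0 y)\<^sup>2 - 2 * (max 0 (y - 1))\<^sup>2 + (max 0 (y - 2))\<^sup>2) / 2"

text \<open>The hat function over \<open>[0, 2]\<close> with peak 1 at 1, written as a second
  difference of positive parts. It is the derivative of \<open>smooth_step\<close> and has integral
  1, so its rescalings form an approximate identity.\<close>

definition tent :: "real \<Rightarrow> real" where
  "tent y = max 0 y - 2 * max 0 (y - 1) + max 0 (y - 2)"

lemma has_derivative_pos_part_square:
  "((\<lambda>y::real. (max 0 y)\<^sup>2) has_real_derivative 2 * max 0 y) (at y)"
proof -
  consider "y < 0" | "y = 0" | "0 < y" by linarith
  then show ?thesis
  proof cases
    case 1
    then have "\<forall>\<^sub>F x in nhds y. x < 0" by (rule order_tendstoD(2)[OF filterlim_ident])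
    then have "\<forall>\<^sub>F x in nhds y. (max 0 x)\<^sup>2 = (0::real)" by eventually_elim simp
    then have "((\<lambda>y::real. (max 0 y)\<^sup>2) has_real_derivative 0) (at y) \<longleftrightarrow> ((\<lambda>y::real. 0::real) has_real_derivative 0) (at y)"
      by (intro DERIV_cong_ev) auto
    with 1 show ?thesis by simp
  next
    case 2
    have "((\<lambda>h::real. (max 0 h)\<^sup>2 / h) \<longlongrightarrow> 0) (at 0)"
    proof (rule Lim_null_comparison)
      show "\<forall>\<^sub>F h in at 0. norm ((max 0 h)\<^sup>2 / h) \<le> \<bar>h::real\<bar>"
        by (rule always_eventually) (auto simp: max_def power2_eq_square)
      show "((\<lambda>h::real. \<bar>h\<bar>) \<longlongrightarrow> 0) (at 0)" by (intro tendsto_rabs_zero tendsto_ident_at)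
    qed
    with 2 show ?thesis by (simp add: DERIV_def)
  next
    case 3
    then have "\<forall>\<^sub>F x in nhds y. 0 < x" by (rule order_tendstoD(1)[OF filterlim_ident])
    then have "\<forall>\<^sub>F x in nhds y. (max 0 x)\<^sup>2 = x\<^sup>2" by eventually_elim simp
    then have "((\<lambda>y::real. (max 0 y)\<^sup>2) has_real_derivative 2 * y) (at y) \<longleftrightarrow> ((\<lambda>y::real. y\<^sup>2) has_real_derivative 2 * y) (at y)"
      by (intro DERIV_cong_ev) auto
    moreover have "((\<lambda>y::real. y\<^sup>2) has_real_derivative 2 * y) (at y)"
      by (auto intro!: derivative_eq_intros)
    ultimately show ?thesis using 3 by simp
  qed
qed

lemma smooth_step_derivative: "(smooth_step has_real_derivative tent y) (at y)"
proof -
  have "((\<lambda>y. (max 0 (y - c))\<^sup>2) has_real_derivative 2 * max 0 (y - c)) (at y)" for c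
  proof -
    have "((\<lambda>y. y - c) has_real_derivative 1) (at y)" by (auto intro!: derivative_eq_intros)
    from DERIV_chain2[where f = "\<lambda>y. (max 0 y)\<^sup>2", OF has_derivative_pos_part_square this]
    show ?thesis by simp
  qed
  from DERIV_cdivide[OF DERIV_add[OF DERIV_diff[OF this[of 0] DERIV_cmult[OF this[of 1], of 2]] this[of 2]], of 2]
  show ?thesis
    unfolding smooth_step_def[abs_def] diff_0_right by (rule DERIV_cong) (simp add: tent_def)
qed

lemma continuous_tent: "continuous_on A tent"
  unfolding tent_def[abs_def] by (intro continuous_intros)

lemma smooth_step_eq:
  "y \<le> 0 \<Longrightarrow> smooth_step y = 0" "2 \<le> y \<Longrightarrow> smooth_step y = 1"
  by (simp_all add: smooth_step_def max_def power2_eq_square field_simps)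

lemma tent_eq: "y \<notin> {0..2} \<Longrightarrow> tent y = 0"
  by (auto simp: tent_def max_def)

lemma tent_nonneg: "0 \<le> tent y"
  by (auto simp: tent_def max_def)

lemma smooth_step_bounds: "0 \<le> smooth_step y" "smooth_step y \<le> 1"
proof -
  have mono: "smooth_step x \<le> smooth_step y" if "x \<le> y" for x y
    by (rule DERIV_nonneg_imp_nondecreasing[OF that]) (use smooth_step_derivative tent_nonneg in blast)
  show "0 \<le> smooth_step y" using mono[of "min y 0" y] smooth_step_eq(1)[of "min y 0"] by simp
  show "smooth_step y \<le> 1" using mono[of y "max y 2"] smooth_step_eq(2)[of "max y 2"] by simp
qed

lemma has_integral_tent: "has_bochner_integral lborel tent 1"
proof -
  have "has_bochner_integral lborel (\<lambda>x. tent x * indicator {0..2} x) (smooth_step 2 - smooth_step 0)"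
    by (rule has_bochner_integral_FTC_Icc_real[OF _ smooth_step_derivative])
       (auto intro!: continuous_on_interior[OF continuous_tent[of UNIV]])
  moreover have "(\<lambda>x. tent x * indicator {0..2} x) = tent"
    using tent_eq by (auto simp: fun_eq_iff indicator_def simp del: atLeastAtMost_iff)
  ultimately show ?thesis by (simp add: smooth_step_eq)
qed

lemma tent_approximation:
  fixes \<theta> :: "real \<Rightarrow> real"
  assumes "continuous_on UNIV \<theta>"
  shows "integrable lborel (\<lambda>x. \<theta> x * (real (Suc k) * tent (real (Suc k) * (x - a))))"
    "(\<lambda>k. LBINT x. \<theta> x * (real (Suc k) * tent (real (Suc k) * (x - a)))) \<longlonglongrightarrow> \<theta> a"
proof -
  have \<theta>m[measurable]: "\<theta> \<in> borel_measurable borel" by (rule borel_measurable_continuous_onI[OF assms])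
  have tm[measurable]: "tent \<in> borel_measurable borel"
    by (rule borel_measurable_continuous_onI[OF continuous_tent])
  have "bounded (\<theta> ` {a..a+2})"
    by (intro compact_imp_bounded compact_continuous_image continuous_on_subset[OF assms]) auto
  then obtain C where "\<forall>y\<in>\<theta> ` {a..a+2}. norm y \<le> C"
    unfolding bounded_iff by blast
  then have C: "\<And>x. x \<in> {a..a+2} \<Longrightarrow> \<bar>\<theta> x\<bar> \<le> C" by auto
  \<comment> \<open>The integrand after substituting \<open>x = a + y / (k + 1)\<close>, the scaling
    factor having cancelled against the Jacobian. All arguments of \<open>\<theta>\<close> stay in
    \<open>[a, a + 2]\<close> on the support of \<open>tent\<close>, hence the uniform bound
    \<open>C\<close>.\<close>
  define I where "I = (\<lambda>k y. \<theta> (a + y / real (Suc k)) * tent y)"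
  have Ib: "norm (I k y) \<le> C * tent y" for k y
  proof (cases "y \<in> {0..2}")
    case True
    then have "0 \<le> y / real (Suc k)" "y / real (Suc k) \<le> y" by (auto simp: field_simps)
    then have "\<bar>\<theta> (a + y / real (Suc k))\<bar> \<le> C" using True by (intro C) auto
    then show ?thesis using tent_nonneg[of y] by (simp add: I_def abs_mult mult_right_mono)
  qed (simp add: I_def tent_eq)
  have Ct: "integrable lborel (\<lambda>y. C * tent y)" using has_integral_tent by (auto simp: has_bochner_integral_iff)
  have Im: "I k \<in> borel_measurable lborel" for k unfolding I_def by measurable
  have Ii: "integrable lborel (I k)" for k
    by (rule Bochner_Integration.integrable_bound[OF Ct Im]) (use Ib order_trans[OF Ib abs_ge_self] in auto)
  have eq: "\<theta> (a + 1 / real (Suc k) * y) * (real (Suc k) * tent (real (Suc k) * (a + 1 / real (Suc k) * y - a)))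
      = real (Suc k) * I k y" for k y
  proof -
    have "\<theta> (a + 1 / c * y) * (c * tent (c * (a + 1 / c * y - a))) = c * (\<theta> (a + y / c) * tent y)"
      if "c \<noteq> 0" for c using that by simp
    from this[of "real (Suc k)"] show ?thesis by (simp only: I_def of_nat_eq_0_iff nat.simps simp_thms)
  qed
  show "integrable lborel (\<lambda>x. \<theta> x * (real (Suc k) * tent (real (Suc k) * (x - a))))"
    using lborel_integrable_real_affine_iff[of "1 / real (Suc k)" "\<lambda>x. \<theta> x * (real (Suc k) * tent (real (Suc k) * (x - a)))" a]
      Ii[of k] unfolding eq by simp
  have "(LBINT x. \<theta> x * (real (Suc k) * tent (real (Suc k) * (x - a)))) = (LBINT y. I k y)" for k
    using lborel_integral_real_affine[of "1 / real (Suc k)" "\<lambda>x. \<theta> x * (real (Suc k) * tent (real (Suc k) * (x - a)))" a]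
    unfolding eq by simp
  moreover have "(\<lambda>k. LBINT y. I k y) \<longlonglongrightarrow> (LBINT y. \<theta> a * tent y)"
  proof (rule integral_dominated_convergence[OF _ Im Ct])
    show "AE y in lborel. (\<lambda>k. I k y) \<longlonglongrightarrow> \<theta> a * tent y"
    proof (rule AE_I2)
      fix y
      have "(\<lambda>k. a + y * inverse (real (Suc k))) \<longlonglongrightarrow> a + y * 0"
        by (intro tendsto_intros LIMSEQ_inverse_real_of_nat)
      then have "(\<lambda>k. a + y / real (Suc k)) \<longlonglongrightarrow> a" by (simp add: divide_inverse)
      moreover have "isCont \<theta> a" using assms by (simp add: continuous_on_eq_continuous_at)
      ultimately have "(\<lambda>k. \<theta> (a + y / real (Suc k))) \<longlonglongrightarrow> \<theta> a" by (metis isCont_tendsto_compose)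
      then show "(\<lambda>k. I k y) \<longlonglongrightarrow> \<theta> a * tent y" unfolding I_def by (intro tendsto_intros)
    qed
  qed (use Ib in auto)
  ultimately show "(\<lambda>k. LBINT x. \<theta> x * (real (Suc k) * tent (real (Suc k) * (x - a)))) \<longlonglongrightarrow> \<theta> a"
    using has_integral_tent by (simp add: has_bochner_integral_iff)
qed

text \<open>At \<open>y = 0\<close> the sequence is constantly 0; this is why differences of two
  steps converge to the indicator of a half-open interval.\<close>

lemma smooth_step_limit:
  "(\<lambda>k. smooth_step (real (Suc k) * y)) \<longlonglongrightarrow> indicator {0<..} y"
proof (cases "0 < y")
  case True
  obtain N where N: "2 / y \<le> real N" using real_arch_simple by blast
  have "\<forall>\<^sub>F k in sequentially. smooth_step (real (Suc k) * y) = 1"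
    using eventually_ge_at_top[of N]
  proof eventually_elim
    case (elim k)
    then have "2 / y \<le> real (Suc k)" using N by linarith
    with True show ?case by (intro smooth_step_eq(2)) (simp add: field_simps)
  qed
  with True show ?thesis by (simp add: tendsto_eventually)
next
  case False
  then have "smooth_step (real (Suc k) * y) = 0" for k
    by (intro smooth_step_eq(1)) (simp add: mult_le_0_iff)
  with False show ?thesis by simp
qed

text \<open>Testing against smoothed indicators of \<open>(a, b]\<close> gives the integral of
  \<open>f\<close> over \<open>[a, b]\<close> in the limit. Their derivatives are tents shrinking to
  \<open>a\<close> and \<open>b\<close>, which by continuity pick out the values of
  \<open>\<theta>\<close> there.\<close>

theorem weak_derivative_primitive:
  assumes \<theta>: "continuous_on UNIV \<theta>" and f: "loc_integrable f" and w: "weak_derivative \<theta> f"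
  shows "primitive_of \<theta> f"
proof -
  have "\<theta> b - \<theta> a = (LBINT r:{a..b}. f r)" if ab: "a \<le> b" for a b
  proof -
    define \<eta> where "\<eta> = (\<lambda>k x. smooth_step (real (Suc k) * (x - a)) - smooth_step (real (Suc k) * (x - b)))"
    define \<eta>' where "\<eta>' = (\<lambda>k x. real (Suc k) * tent (real (Suc k) * (x - a)) - real (Suc k) * tent (real (Suc k) * (x - b)))"
    have d: "((\<lambda>x. smooth_step (real (Suc k) * (x - c))) has_real_derivative real (Suc k) * tent (real (Suc k) * (x - c))) (at x)" for k c x
    proof -
      have "((\<lambda>x. real (Suc k) * (x - c)) has_real_derivative real (Suc k)) (at x)"
        by (auto intro!: derivative_eq_intros)
      from DERIV_chain2[OF smooth_step_derivative this] show ?thesis by (simp add: mult.commute)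
    qed
    have \<eta>d: "(\<eta> k has_real_derivative \<eta>' k x) (at x)" for k x
      unfolding \<eta>_def \<eta>'_def by (intro DERIV_diff d)
    have \<eta>c: "continuous_on UNIV (\<eta>' k)" for k
      unfolding \<eta>'_def by (intro continuous_intros continuous_on_compose2[OF continuous_tent[of UNIV]]) auto
    \<comment> \<open>Each step has width \<open>2 / (k + 1) \<le> 2\<close>. A support independent
      of \<open>k\<close> yields the dominating function for the limit.\<close>
    have \<eta>0: "\<eta> k x = 0" if "x \<notin> {a..b+2}" for k x
    proof (cases "x < a")
      case True
      then have "real (Suc k) * (x - a) \<le> 0" "real (Suc k) * (x - b) \<le> 0"
        using ab by (auto simp: mult_le_0_iff)
      then show ?thesis by (simp add: \<eta>_def smooth_step_eq)
    next
      case False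
      with that have "b + 2 < x" by auto
      then have "1 * 2 \<le> real (Suc k) * (x - b)" "1 * 2 \<le> real (Suc k) * (x - a)"
        using ab by (intro mult_mono; simp)+
      then show ?thesis by (simp add: \<eta>_def smooth_step_eq)
    qed
    have "\<exists>R. \<forall>x. R < \<bar>x\<bar> \<longrightarrow> \<eta> k x = 0" for k
      by (intro exI[of _ "\<bar>a\<bar> + \<bar>b\<bar> + 2"] allI impI \<eta>0) auto
    then have W: "(LBINT x. \<theta> x * \<eta>' k x) = - (LBINT x. f x * \<eta> k x)" for k
      using w \<eta>d \<eta>c unfolding weak_derivative_def by blast
    have "(\<lambda>k. LBINT x. \<theta> x * \<eta>' k x) \<longlonglongrightarrow> \<theta> a - \<theta> b"
    proof -
      have "(LBINT x. \<theta> x * \<eta>' k x) = (LBINT x. \<theta> x * (real (Suc k) * tent (real (Suc k) * (x - a))))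
          - (LBINT x. \<theta> x * (real (Suc k) * tent (real (Suc k) * (x - b))))" for k
        using Bochner_Integration.integral_diff[OF tent_approximation(1)[OF \<theta>, of k a] tent_approximation(1)[OF \<theta>, of k b]]
        by (simp only: \<eta>'_def right_diff_distrib[of "\<theta> _"])
      then show ?thesis by (simp only:) (intro tendsto_diff tent_approximation(2)[OF \<theta>])
    qed
    moreover have "(\<lambda>k. LBINT x. f x * \<eta> k x) \<longlonglongrightarrow> (LBINT x. f x * indicator {a<..b} x)"
    proof (rule integral_dominated_convergence[where w = "\<lambda>x. indicator {a..b+2} x * \<bar>f x\<bar>"])
      have fm: "f \<in> borel_measurable borel" by (rule loc_integrable_measurable[OF f])
      then show "(\<lambda>x. f x * indicator {a<..b} x) \<in> borel_measurable lborel" by simp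
      have "continuous_on UNIV (\<eta> k)" for k
        using \<eta>d by (meson DERIV_isCont continuous_at_imp_continuous_on)
      then have "\<eta> k \<in> borel_measurable borel" for k by (rule borel_measurable_continuous_onI)
      with fm show "(\<lambda>x. f x * \<eta> k x) \<in> borel_measurable lborel" for k by simp
      show "integrable lborel (\<lambda>x. indicator {a..b+2} x * \<bar>f x\<bar>)"
        using loc_integrableD(1)[OF loc_integrable_abs[OF f]] by (simp add: set_integrable_def)
      show "AE x in lborel. (\<lambda>k. f x * \<eta> k x) \<longlonglongrightarrow> f x * indicator {a<..b} x"
      proof (rule AE_I2, intro tendsto_mult tendsto_const)
        fix x
        have "(\<lambda>k. \<eta> k x) \<longlonglongrightarrow> indicator {0<..} (x - a) - indicator {0<..} (x - b)"
          unfolding \<eta>_def by (intro tendsto_diff smooth_step_limit)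
        also have "indicator {0<..} (x - a) - indicator {0<..} (x - b) = (indicator {a<..b} x :: real)"
          using ab by (auto simp: indicator_def)
        finally show "(\<lambda>k. \<eta> k x) \<longlonglongrightarrow> indicator {a<..b} x" .
      qed
      show "AE x in lborel. norm (f x * \<eta> k x) \<le> indicator {a..b+2} x * \<bar>f x\<bar>" for k
      proof (rule AE_I2)
        fix x
        have "\<bar>\<eta> k x\<bar> \<le> indicator {a..b+2} x"
          using smooth_step_bounds[of "real (Suc k) * (x - a)"] smooth_step_bounds[of "real (Suc k) * (x - b)"] \<eta>0[of x k]
          by (auto simp: \<eta>_def indicator_def split: if_splits)
        then have "\<bar>f x\<bar> * \<bar>\<eta> k x\<bar> \<le> \<bar>f x\<bar> * indicator {a..b+2} x" by (rule mult_left_mono) simp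
        then show "norm (f x * \<eta> k x) \<le> indicator {a..b+2} x * \<bar>f x\<bar>" by (simp add: abs_mult mult.commute)
      qed
    qed
    ultimately have "\<theta> a - \<theta> b = - (LBINT x. f x * indicator {a<..b} x)"
      unfolding W using LIMSEQ_unique tendsto_minus by blast
    moreover have "(LBINT x. f x * indicator {a<..b} x) = (LBINT r:{a..b}. f r)"
      unfolding set_lebesgue_integral_def
    proof (rule integral_cong_AE)
      show "AE x in lborel. f x * indicator {a<..b} x = indicator {a..b} x *\<^sub>R f x"
        using AE_lborel_singleton[of a] by eventually_elim (auto simp: indicator_def)
    qed (use loc_integrable_measurable[OF f] in auto)
    ultimately show ?thesis by simp
  qed
  with f show ?thesis by (simp add: primitive_of_def)
qed

section \<open>Decay rates of monotone functions\<close>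

lemma primitive_of_cmult: "primitive_of F f \<Longrightarrow> primitive_of (\<lambda>x. c * F x) (\<lambda>x. c * f x)"
  unfolding primitive_of_def loc_integrable_def by (auto simp flip: right_diff_distrib)

lemma primitive_of_shift:
  assumes "primitive_of F f"
  shows "primitive_of (\<lambda>x. F (x + d)) (\<lambda>x. f (x + d))"
proof -
  have eq: "indicator {s + d..t + d} (d + 1 * r) *\<^sub>R f (d + 1 * r) = indicator {s..t} r *\<^sub>R f (r + d)" for s t r
    by (auto simp: indicator_def add.commute)
  have "set_integrable lborel {s..t} (\<lambda>x. f (x + d))" for s t
    using loc_integrableD(1)[OF primitive_ofD(1)[OF assms], of "s + d" "t + d"]
      lborel_integrable_real_affine_iff[of 1 "\<lambda>r. indicator {s + d..t + d} r *\<^sub>R f r" d]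
    unfolding set_integrable_def eq by simp
  moreover have "(LBINT r:{s..t}. f (r + d)) = (LBINT r:{s + d..t + d}. f r)" for s t
    using lborel_integral_real_affine[of 1 "\<lambda>r. indicator {s + d..t + d} r *\<^sub>R f r" d]
    unfolding set_lebesgue_integral_def eq by simp
  ultimately show ?thesis
    using primitive_ofD(2)[OF assms] by (simp add: primitive_of_def loc_integrable_def)
qed

lemma primitive_bounds:
  assumes "primitive_of F f" "\<And>x. 0 \<le> f x" "\<And>x. f x \<le> C" "s \<le> t"
  shows "0 \<le> F t - F s" "F t - F s \<le> C * (t - s)"
proof -
  have F: "F t - F s = integral {s..t} f"
    using primitive_ofD(2)[OF assms(1,4)] loc_integrableD(3)[OF primitive_ofD(1)[OF assms(1)]] by simp
  have i: "f integrable_on {s..t}" by (rule loc_integrableD(2)[OF primitive_ofD(1)[OF assms(1)]])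
  show "0 \<le> F t - F s" unfolding F by (rule integral_nonneg[OF i]) (rule assms(2))
  have "integral {s..t} f \<le> integral {s..t} (\<lambda>_. C)"
    by (rule integral_le[OF i]) (use assms in auto)
  also have "\<dots> = C * (t - s)" using assms(4) by (simp add: mult.commute)
  finally show "F t - F s \<le> C * (t - s)" unfolding F .
qed

text \<open>Fatou's lemma for the difference quotients \<open>n (G r - G (r + 1/n))\<close>.\<close>

lemma nonincreasing_derivative_bound:
  fixes G :: "real \<Rightarrow> real"
  assumes G: "\<And>s t. T \<le> s \<Longrightarrow> s \<le> t \<Longrightarrow> G t \<le> G s" and L: "\<And>t. T \<le> t \<Longrightarrow> L \<le> G t"
  obtains w :: "real \<Rightarrow> ennreal" where "w \<in> borel_measurable borel" "(\<integral>\<^sup>+r. w r \<partial>lborel) \<le> ennreal (G T - L)"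
    "\<And>r D. T \<le> r \<Longrightarrow> (G has_real_derivative D) (at r) \<Longrightarrow> ennreal (- D) \<le> w r"
proof -
  \<comment> \<open>Freezing \<open>G\<close> before \<open>T\<close> and subtracting
    \<open>L\<close> keeps \<open>H\<close> nonincreasing on the whole line with values in
    \<open>[0, G T - L]\<close>.\<close>
  define H where "H = (\<lambda>r. G (max r T) - L)"
  have Hm: "H t \<le> H s" if "s \<le> t" for s t using G[of "max s T" "max t T"] that by (auto simp: H_def max_def)
  have H0: "0 \<le> H r" for r using L[of "max r T"] by (simp add: H_def)
  have HT: "H r \<le> G T - L" for r using G[of T "max r T"] by (simp add: H_def)
  have "mono (\<lambda>r. - H r)" by (rule monoI) (use Hm in simp)
  then have "(\<lambda>r. - (- H r)) \<in> borel_measurable borel" by (intro borel_measurable_uminus borel_measurable_mono)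
  then have Hb[measurable]: "H \<in> borel_measurable borel" by simp
  have "loc_integrable H"
  proof (rule loc_integrable_bound[OF _ Hb])
    show "loc_integrable (\<lambda>_. G T - L)" by (auto simp: loc_integrable_def set_integrable_def intro!: integrable_real_indicator emeasure_lborel_Icc_eq[THEN eq_refl, THEN le_less_trans])
    show "\<bar>H x\<bar> \<le> \<bar>G T - L\<bar>" for x using H0[of x] HT[of x] by simp
  qed
  then obtain P where P: "primitive_of P H" by (rule loc_integrable_primitive)
  define k where "k = (\<lambda>(n::nat) r. real (Suc n) * (H r - H (r + 1 / real (Suc n))))"
  \<comment> \<open>On a finite window the integral is an increment of a primitive; every
    \<open>r \<ge> T\<close> lies in all windows from some \<open>n\<close> on.\<close>
  define q where "q = (\<lambda>(n::nat) r. ennreal (k n r) * indicator {T..T + real n} r)"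
  have k0: "0 \<le> k n r" for n r unfolding k_def by (intro mult_nonneg_nonneg) (use Hm in auto)
  have q_int: "(\<integral>\<^sup>+r. q n r \<partial>lborel) \<le> ennreal (G T - L)" for n
  proof -
    define d where "d = 1 / real (Suc n)"
    \<comment> \<open>The increment of \<open>Q\<close> over the window telescopes to the mean of
      \<open>H\<close> over \<open>[T, T + d]\<close> minus its mean over
      \<open>[T + n, T + n + d]\<close>. The first is at most \<open>G T - L\<close>, the second
      nonnegative.\<close>
    define Q where "Q = (\<lambda>r. real (Suc n) * (P r - P (r + d)))"
    have "primitive_of Q (k n)"
      unfolding Q_def k_def d_def by (intro primitive_of_cmult primitive_of_diff primitive_of_shift P)
    from primitive_nn_integral[OF this k0, of T "T + real n"]
    have "(\<integral>\<^sup>+r. q n r \<partial>lborel) = ennreal (Q (T + real n) - Q T)" by (simp add: q_def)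
    also have "Q (T + real n) - Q T \<le> G T - L"
    proof -
      have d: "0 < d" "real (Suc n) * d = 1" by (simp_all add: d_def)
      have "0 \<le> P (T + real n + d) - P (T + real n)" "P (T + d) - P T \<le> (G T - L) * d"
        using primitive_bounds[OF P H0 HT, of "T + real n" "T + real n + d"]
          primitive_bounds[OF P H0 HT, of T "T + d"] d by auto
      then have "Q (T + real n) - Q T \<le> real (Suc n) * ((G T - L) * d)"
        unfolding Q_def right_diff_distrib[symmetric] by (intro mult_left_mono) auto
      also have "\<dots> = G T - L" using d(2) by (simp only: mult.left_commute[of _ "G T - L"] mult_1_right)
      finally show ?thesis .
    qed
    finally show ?thesis by (simp add: ennreal_leI)
  qed
  have qb[measurable]: "q n \<in> borel_measurable borel" for n unfolding q_def k_def by measurable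
  define w where "w = (\<lambda>r. liminf (\<lambda>n. q n r))"
  show thesis
  proof (rule that)
    show "w \<in> borel_measurable borel" unfolding w_def by measurable
    have "(\<integral>\<^sup>+r. w r \<partial>lborel) \<le> liminf (\<lambda>n. \<integral>\<^sup>+r. q n r \<partial>lborel)"
      unfolding w_def by (rule nn_integral_liminf) simp
    also have "\<dots> \<le> liminf (\<lambda>n::nat. ennreal (G T - L))"
      by (intro Liminf_mono always_eventually allI q_int)
    finally show "(\<integral>\<^sup>+r. w r \<partial>lborel) \<le> ennreal (G T - L)" by (simp add: Liminf_const)
  next
    fix r D assume r: "T \<le> r" and D: "(G has_real_derivative D) (at r)"
    \<comment> \<open>Only forward increments occur, so freezing \<open>G\<close> before
      \<open>T\<close> does not disturb the quotient, even at \<open>r = T\<close>.\<close>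
    have "(\<lambda>n. k n r) \<longlonglongrightarrow> - D"
    proof -
      have "(\<lambda>n. 1 / real (Suc n)) \<longlonglongrightarrow> 0"
        using LIMSEQ_inverse_real_of_nat by (simp add: inverse_eq_divide)
      then have "filterlim (\<lambda>n. 1 / real (Suc n)) (at 0) sequentially"
        by (simp add: filterlim_at)
      with D have "(\<lambda>n. (G (r + 1 / real (Suc n)) - G r) / (1 / real (Suc n))) \<longlonglongrightarrow> D"
        unfolding DERIV_def by (rule filterlim_compose)
      then have "(\<lambda>n. - ((G (r + 1 / real (Suc n)) - G r) / (1 / real (Suc n)))) \<longlonglongrightarrow> - D"
        by (rule tendsto_minus)
      also have "(\<lambda>n. - ((G (r + 1 / real (Suc n)) - G r) / (1 / real (Suc n)))) = (\<lambda>n. k n r)"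
      proof
        fix n
        have "T \<le> r + 1 / real (Suc n)" using r by (simp add: add_increasing2)
        with r have "max r T = r" "max (r + 1 / real (Suc n)) T = r + 1 / real (Suc n)" by auto
        then show "- ((G (r + 1 / real (Suc n)) - G r) / (1 / real (Suc n))) = k n r"
          by (simp add: k_def H_def algebra_simps)
      qed
      finally show ?thesis .
    qed
    then have lim: "(\<lambda>n. ennreal (k n r)) \<longlonglongrightarrow> ennreal (- D)" by (rule tendsto_ennrealI)
    obtain n0 where n0: "r - T \<le> real n0" using real_arch_simple by blast
    have "\<forall>\<^sub>F n in sequentially. ennreal (k n r) = q n r"
      using eventually_ge_at_top[of n0]
    proof eventually_elim
      case (elim n)
      then have "r \<le> T + real n" using n0 by linarith
      with r show ?case by (simp add: q_def)
    qed
    with lim have "(\<lambda>n. q n r) \<longlonglongrightarrow> ennreal (- D)" by (rule Lim_transform_eventually)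
    then show "ennreal (- D) \<le> w r" unfolding w_def by (simp add: lim_imp_Liminf)
  qed
qed

text \<open>Near a point with nonzero derivative, \<open>h\<close> expands distances to that point
  by a positive factor, so it cannot take a set of positive measure of such points into a null set.
  In dimension one, injectivity of the derivative means that it is nonzero.\<close>

lemma AE_derivative_eq_0_on_negligible_vimage:
  fixes h :: "real \<Rightarrow> real"
  assumes "negligible B"
  shows "AE t in lborel. \<forall>D. (h has_real_derivative D) (at t) \<longrightarrow> D \<noteq> 0 \<longrightarrow> h t \<notin> B"
proof -
  define S where "S = {t. \<exists>D. (h has_real_derivative D) (at t) \<and> D \<noteq> 0}"
  have S: "(h has_real_derivative deriv h t) (at t)" "deriv h t \<noteq> 0" if "t \<in> S" for t
    using that by (auto simp: S_def DERIV_imp_deriv)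
  have "negligible {t \<in> S. h t \<in> B}"
  proof (rule negligible_differentiable_vimage[OF assms])
    show "(h has_derivative (*) (deriv h t)) (at t within S)" if "t \<in> S" for t
      using S(1)[OF that] by (simp add: has_field_derivative_def has_derivative_at_withinI)
    show "inj ((*) (deriv h t))" if "t \<in> S" for t
      using S(2)[OF that] by (auto simp: inj_on_def)
  qed
  from negligible_imp_AE_lborel[OF this] show ?thesis
    by eventually_elim (auto simp: S_def)
qed

text \<open>A first exit time would be attained, as the set of exit times is closed. Before it the
  curve is inside the ball, so \<open>step\<close> limits the displacement up to that time to less
  than \<open>\<delta> / 2\<close>; with the starting distance this stays below
  \<open>\<delta>\<close>, a contradiction.\<close>

lemma continuous_curve_trapped:
  fixes v :: "real \<Rightarrow> 'a::metric_space"
  assumes c: "continuous_on {T..} v" and start: "dist (v T) x < \<delta> / 2"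
    and step: "\<And>t. T \<le> t \<Longrightarrow> (\<And>r. T \<le> r \<Longrightarrow> r < t \<Longrightarrow> dist (v r) x < \<delta>) \<Longrightarrow> dist (v T) (v t) < \<delta> / 2"
    and t: "T \<le> t"
  shows "dist (v t) x < \<delta>"
proof (rule ccontr)
  assume "\<not> dist (v t) x < \<delta>"
  define S where "S = {r \<in> {T..t}. \<delta> \<le> dist (v r) x}"
  have "continuous_on {T..t} (\<lambda>r. dist (v r) x)"
    by (intro continuous_intros continuous_on_subset[OF c]) auto
  then have "closed ({T..t} \<inter> (\<lambda>r. dist (v r) x) -` {\<delta>..})"
    by (rule continuous_closed_preimage) auto
  also have "{T..t} \<inter> (\<lambda>r. dist (v r) x) -` {\<delta>..} = S" by (auto simp: S_def)
  finally have cl: "closed S" .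
  have ne: "t \<in> S" using t \<open>\<not> dist (v t) x < \<delta>\<close> by (simp add: S_def)
  have bd: "bdd_below S" by (rule bdd_belowI[of _ T]) (simp add: S_def)
  have I: "Inf S \<in> S" by (rule closed_contains_Inf) (use ne bd cl in auto)
  have "dist (v T) (v (Inf S)) < \<delta> / 2"
  proof (rule step)
    show "T \<le> Inf S" using I by (simp add: S_def)
    fix r assume r: "T \<le> r" "r < Inf S"
    then have "r \<notin> S" using cInf_lower[OF _ bd] by force
    with r I show "dist (v r) x < \<delta>" by (auto simp: S_def)
  qed
  with start have "dist (v (Inf S)) x < \<delta>"
    using dist_triangle[of "v (Inf S)" x "v T"] by (simp add: dist_commute)
  with I show False by (simp add: S_def)
qed

text \<open>If \<open>E \<phi>\<close> exceeded \<open>E (v t)\<close>, lower semicontinuity would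
  keep the energy above \<open>E (v t)\<close> along the approximating sequence, against
  monotonicity at late times.\<close>

lemma omega_limit_energy_le:
  assumes lsc: "lsc_on (closure (v ` {tbar..})) E" and \<phi>: "\<phi> \<in> omega_limit v"
    and mono: "\<And>s t. 0 < s \<Longrightarrow> s \<le> t \<Longrightarrow> E (v t) \<le> E (v s)" and t: "0 < t"
  shows "E \<phi> \<le> E (v t)"
proof (rule ccontr)
  assume less: "\<not> E \<phi> \<le> E (v t)"
  from \<phi> obtain \<tau> :: "nat \<Rightarrow> real" where \<tau>: "filterlim \<tau> at_top sequentially" "(\<lambda>n. v (\<tau> n)) \<longlonglongrightarrow> \<phi>"
    by (auto simp: omega_limit_def)
  let ?S = "closure (v ` {tbar..})"
  have ev: "\<forall>\<^sub>F n in sequentially. c \<le> \<tau> n" for c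
    using \<tau>(1) by (simp add: filterlim_at_top)
  have "\<phi> \<in> ?S"
  proof (rule Lim_in_closed_set[OF _ _ _ \<tau>(2)])
    show "\<forall>\<^sub>F n in sequentially. v (\<tau> n) \<in> ?S"
      using ev[of tbar] by eventually_elim (use closure_subset in force)
  qed auto
  then have "E (v t) < Liminf (at \<phi> within ?S) E"
    using lsc less by (auto simp: lsc_on_def)
  then have "\<forall>\<^sub>F u in at \<phi> within ?S. E (v t) < E u" by (rule less_LiminfD)
  then obtain U where U: "open U" "\<phi> \<in> U" "\<And>u. u \<in> U \<Longrightarrow> u \<noteq> \<phi> \<Longrightarrow> u \<in> ?S \<Longrightarrow> E (v t) < E u"
    unfolding eventually_at_topological by blast
  have "\<forall>\<^sub>F n in sequentially. v (\<tau> n) \<in> U" using topological_tendstoD[OF \<tau>(2) U(1,2)] .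
  with ev[of "max t tbar"] have "\<forall>\<^sub>F n in sequentially. False"
  proof eventually_elim
    case (elim n)
    have "v (\<tau> n) \<in> ?S" using elim closure_subset by force
    \<comment> \<open>The filter \<open>at \<phi> within ?S\<close> omits its centre, so the case
      \<open>v (\<tau> n) = \<phi>\<close> is settled by \<open>less\<close> instead.\<close>
    then have "E (v t) < E (v (\<tau> n))" using U(3)[OF elim(2)] less by (cases "v (\<tau> n) = \<phi>") auto
    moreover have "E (v (\<tau> n)) \<le> E (v t)" using mono[OF t] elim(1) by simp
    ultimately show False by simp
  qed
  then show False by simp
qed

section \<open>Gradient flows\<close>

lemma gradient_flowD:
  assumes "gradient_flow p E g v"
  shows "AC_loc 0 \<infinity> v"
    "0 < t \<Longrightarrow> \<bar>E (v t)\<bar> \<noteq> \<infinity>"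
    "0 < s \<Longrightarrow> s \<le> t \<Longrightarrow> E (v t) \<le> E (v s)"
    "AE t in lborel. t > 0 \<longrightarrow> g (v t) < \<infinity> \<and>
       (\<exists>D. ((\<lambda>s. real_of_ereal (E (v s))) has_real_derivative D) (at t) \<and>
            D \<le> - (1 / (p / (p - 1))) * enn2real (g (v t)) powr (p / (p - 1))
              - (1 / p) * metric_derivative v t powr p)"
proof -
  note flow = assms[unfolded gradient_flow_def Let_def]
  show "AC_loc 0 \<infinity> v" by (rule flow[THEN conjunct1])
  show "0 < t \<Longrightarrow> \<bar>E (v t)\<bar> \<noteq> \<infinity>"
    by (rule flow[THEN conjunct2, THEN conjunct1, rule_format])
  show "0 < s \<Longrightarrow> s \<le> t \<Longrightarrow> E (v t) \<le> E (v s)"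
    by (rule flow[THEN conjunct2, THEN conjunct2, THEN conjunct1, rule_format]) (rule conjI)
qed (rule assms[unfolded gradient_flow_def Let_def, THEN conjunct2, THEN conjunct2, THEN conjunct2])

lemma real_of_ereal_le_mono:
  assumes "\<bar>x\<bar> \<noteq> \<infinity>" "\<bar>y\<bar> \<noteq> \<infinity>" "x \<le> y"
  shows "real_of_ereal x \<le> real_of_ereal y"
  using assms by (cases x; cases y) auto

text \<open>Off the null set of levels at which \<open>\<theta>\<close> has no positive derivative, the KL inequality and
  Young's inequality bound the speed by the decay rate of \<open>\<theta> \<circ> h\<close>, where \<open>h\<close> is the relative energy
  along the flow; at the remaining times \<open>h' = 0\<close> almost everywhere, so the speed vanishes.\<close>

lemma gradient_flow_speed_bound:
  fixes E :: "'a::metric_space \<Rightarrow> ereal"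
  assumes p: "1 < p" and flow: "gradient_flow p E g v" and \<phi>: "\<bar>E \<phi>\<bar> \<noteq> \<infinity>"
    and ge: "\<And>t. 0 < t \<Longrightarrow> E \<phi> \<le> E (v t)"
    and \<theta>: "strict_mono \<theta>" "\<theta> \<in> W11_loc" "\<theta> 0 = 0"
    and crit: "{s. \<theta> s > 0 \<and> (\<theta> has_real_derivative 0) (at s)} \<in> null_sets lebesgue"
    and KL: "\<forall>u \<in> KL_set E \<theta> \<phi> \<epsilon>.
           ennreal (deriv \<theta> (real_of_ereal (rel_energy E \<phi> u))) * g u \<ge> 1"
    and md: "AE t in lborel. 0 < t \<longrightarrow> 0 \<le> metric_derivative v t"
  shows "AE t in lborel. 0 < t \<longrightarrow> dist (v t) \<phi> < \<epsilon> \<longrightarrow> metric_derivative v t \<le> 0 \<or>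
     (\<exists>D. ((\<lambda>t. \<theta> (real_of_ereal (E (v t)) - real_of_ereal (E \<phi>))) has_real_derivative D) (at t) \<and>
          metric_derivative v t \<le> - D)"
proof -
  define q where "q = p / (p - 1)"
  have q: "1 < q" "1 / p + 1 / q = 1" using p by (auto simp: q_def field_simps)
  define h where "h = (\<lambda>t. real_of_ereal (E (v t)) - real_of_ereal (E \<phi>))"
  have fin: "\<bar>E (v t)\<bar> \<noteq> \<infinity>" if "0 < t" for t by (rule gradient_flowD(2)[OF flow that])
  have h0: "0 \<le> h t" if "0 < t" for t
    using real_of_ereal_le_mono[OF \<phi> fin[OF that] ge[OF that]] by (simp add: h_def)
  have rel: "rel_energy E \<phi> (v t) = ereal (h t)" if "0 < t" for t
    unfolding rel_energy_def h_def ereal_minus(1)[symmetric]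
    by (simp only: ereal_real'[OF fin[OF that]] ereal_real'[OF \<phi>])
  from \<theta>(2) obtain f where f: "continuous_on UNIV \<theta>" "loc_integrable f" "weak_derivative \<theta> f"
    by (auto simp: W11_loc_def loc_integrable_def)
  \<comment> \<open>The nonnegative levels outside \<open>B\<close> are those at which the KL
    inequality is available: positive, with \<open>\<theta>\<close> differentiable and its
    derivative positive.\<close>
  define B where "B = {0} \<union> {x. \<not> (\<theta> has_real_derivative f x) (at x)} \<union>
     {s. \<theta> s > 0 \<and> (\<theta> has_real_derivative 0) (at s)}"
  have "negligible B" unfolding B_def
    using crit AE_lborel_imp_negligible[OF primitive_AE_has_derivative[OF weak_derivative_primitive[OF f]]]
    by (intro negligible_Un) (auto simp: negligible_iff_null_sets[symmetric])
  \<comment> \<open>Strict monotonicity and \<open>\<theta> 0 = 0\<close> give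
    \<open>\<theta> x > 0\<close> for \<open>x > 0\<close>, so a vanishing derivative at a positive
    level falls under the null set of critical levels.\<close>
  have good: "\<theta> differentiable (at x) \<and> deriv \<theta> x > 0 \<and> x > 0" if "x \<notin> B" "0 \<le> x" for x
  proof -
    from that have x: "0 < x" and d: "(\<theta> has_real_derivative f x) (at x)" by (auto simp: B_def)
    have "0 < \<theta> x" using \<theta>(1,3) x strict_monoD by fastforce
    with that d have "f x \<noteq> 0" by (auto simp: B_def)
    moreover have "0 \<le> f x"
      by (rule mono_on_imp_deriv_nonneg[OF _ d, of UNIV]) (use \<theta>(1) strict_mono_mono in auto)
    ultimately show ?thesis using x d by (auto simp: DERIV_imp_deriv real_differentiable_def)
  qed
  have "AE t in lborel. t > 0 \<longrightarrow> g (v t) < \<infinity> \<and>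
         (\<exists>D. ((\<lambda>s. real_of_ereal (E (v s))) has_real_derivative D) (at t) \<and>
              D \<le> - (1 / q) * enn2real (g (v t)) powr q - (1 / p) * metric_derivative v t powr p)"
    using gradient_flowD(4)[OF flow] unfolding q_def .
  with AE_derivative_eq_0_on_negligible_vimage[OF \<open>negligible B\<close>, of h] md show ?thesis
  proof eventually_elim
    case (elim t)
    show ?case
    proof (intro impI)
      assume t: "0 < t" and ball: "dist (v t) \<phi> < \<epsilon>"
      let ?m = "metric_derivative v t" and ?g = "enn2real (g (v t))"
      have m0: "0 \<le> ?m" using elim t by blast
      from elim t obtain D where gfin: "g (v t) < \<infinity>"
        and D: "((\<lambda>s. real_of_ereal (E (v s))) has_real_derivative D) (at t)"
        and le: "D \<le> - (1 / q) * ?g powr q - (1 / p) * ?m powr p" by blast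
      have hD: "(h has_real_derivative D) (at t)"
        unfolding h_def using DERIV_diff[OF D DERIV_const] by simp
      have young: "?m * ?g \<le> - D"
        using Youngs_inequality[OF p q m0, of ?g] le by simp
      show "?m \<le> 0 \<or> (\<exists>D. ((\<lambda>t. \<theta> (real_of_ereal (E (v t)) - real_of_ereal (E \<phi>))) has_real_derivative D) (at t) \<and> ?m \<le> - D)"
      proof (cases "D = 0")
        case True
        have "0 \<le> 1 / q * ?g powr q" using q by simp
        with le True have "1 / p * ?m powr p \<le> 0" by linarith
        then have "?m powr p \<le> 0" using p by (simp add: divide_le_0_iff)
        then have "?m = 0" using powr_gt_zero[of ?m p] by linarith
        then show ?thesis by simp
      next
        case False
        with elim(1) hD have "h t \<notin> B" by blast
        with good h0[OF t] have \<theta>h: "\<theta> differentiable (at (h t))" "deriv \<theta> (h t) > 0" "h t > 0" by auto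
        let ?d = "deriv \<theta> (h t)"
        have "v t \<in> KL_set E \<theta> \<phi> \<epsilon>"
          using \<theta>h ball by (simp add: KL_set_def rel[OF t] dist_commute)
        with KL have "1 \<le> ennreal ?d * g (v t)" by (auto simp: rel[OF t])
        also have "\<dots> = ennreal (?d * ?g)"
          using gfin \<theta>h(2) by (simp add: ennreal_mult)
        finally have one: "1 \<le> ?d * ?g" by (simp add: one_ennreal_def[symmetric] ennreal_le_iff2 flip: ennreal_1)
        have "(\<theta> has_real_derivative ?d) (at (h t))"
          using \<theta>h(1) by (metis DERIV_deriv_iff_real_differentiable)
        from DERIV_chain2[OF this hD]
        have "((\<lambda>t. \<theta> (h t)) has_real_derivative ?d * D) (at t)" .
        moreover have "?m \<le> - (?d * D)"
        proof -
          have "?m \<le> (?d * ?g) * ?m" using mult_right_mono[OF one m0] by simp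
          also have "\<dots> = ?d * (?m * ?g)" by simp
          also have "\<dots> \<le> ?d * (- D)" using young \<theta>h(2) by (intro mult_left_mono) auto
          finally show ?thesis by simp
        qed
        ultimately show ?thesis unfolding h_def by blast
      qed
    qed
  qed
qed

theorem theorem3p21:
  fixes E :: "'a::complete_space \<Rightarrow> ereal"
    and g :: "'a \<Rightarrow> ennreal"
    and v :: "real \<Rightarrow> 'a"
    and \<phi> :: 'a
    and \<theta> :: "real \<Rightarrow> real"
    and p tbar \<epsilon> :: real
  assumes "1 < p"
    and "proper_functional E"
    and "strong_upper_gradient E g"
    and "gradient_flow p E g v"
    and "omega_limit v \<noteq> {}"
    and "tbar \<ge> 0"
    and "lsc_on (closure (v ` {tbar..})) E"
    and "\<phi> \<in> omega_limit v"
    and "g \<phi> = 0"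
    and "\<epsilon> > 0"
    and "ball \<phi> \<epsilon> \<inter> {u. rel_energy E \<phi> u > 0} \<subseteq> {u. g u > 0}"
    and "strict_mono \<theta>"
    and "\<theta> \<in> W11_loc"
    and "\<theta> 0 = 0"
    and "{s. \<theta> s > 0 \<and> (\<theta> has_real_derivative 0) (at s)} \<in> null_sets lebesgue"
    and "\<forall>u \<in> KL_set E \<theta> \<phi> \<epsilon>.
           ennreal (deriv \<theta> (real_of_ereal (rel_energy E \<phi> u))) * g u \<ge> 1"
  shows "curve_length v < \<infinity> \<and> (v \<longlongrightarrow> \<phi>) at_top"
proof -
  note flow = \<open>gradient_flow p E g v\<close> and \<theta>mono = \<open>strict_mono \<theta>\<close>
  let ?md = "metric_derivative v"
  have fin: "\<bar>E (v t)\<bar> \<noteq> \<infinity>" if "0 < t" for t by (rule gradient_flowD(2)[OF flow that])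
  have mono: "E (v t) \<le> E (v s)" if "0 < s" "s \<le> t" for s t
    by (rule gradient_flowD(3)[OF flow that])
  have "g \<phi> < \<infinity>" using \<open>g \<phi> = 0\<close> by simp
  then have "E \<phi> < \<infinity>"
    using \<open>strong_upper_gradient E g\<close> unfolding strong_upper_gradient_def eff_domain_def by blast
  then have \<phi>fin: "\<bar>E \<phi>\<bar> \<noteq> \<infinity>"
    using \<open>proper_functional E\<close> by (auto simp: proper_functional_def)
  have ge: "E \<phi> \<le> E (v t)" if "0 < t" for t
    using omega_limit_energy_le[OF assms(7,8) mono that] .
  obtain m where m: "loc_integrable m" "\<And>x. 0 \<le> m x" and vc: "continuous_on {0<..} v"
    and md: "AE t in lborel. 0 < t \<longrightarrow> 0 \<le> ?md t \<and> ?md t \<le> m t"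
    and vlen: "\<And>s t. 0 < s \<Longrightarrow> s \<le> t \<Longrightarrow> ennreal (dist (v s) (v t)) \<le> (\<integral>\<^sup>+r\<in>{s..t}. ennreal (?md r) \<partial>lborel)"
    by (rule AC_loc_metric_derivative[OF gradient_flowD(1)[OF flow]]) (rule that)
  define G where "G = (\<lambda>t. \<theta> (real_of_ereal (E (v t)) - real_of_ereal (E \<phi>)))"
  have Gmono: "G t \<le> G s" if "0 < s" "s \<le> t" for s t
    unfolding G_def
    by (intro monoD[OF strict_mono_mono[OF \<theta>mono]] diff_right_mono real_of_ereal_le_mono fin mono)
       (use that in auto)
  have G0: "0 \<le> G t" if "0 < t" for t
  proof -
    have "\<theta> 0 \<le> G t" unfolding G_def
      using real_of_ereal_le_mono[OF \<phi>fin fin[OF that] ge[OF that]]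
      by (intro monoD[OF strict_mono_mono[OF \<theta>mono]]) simp
    then show ?thesis using \<open>\<theta> 0 = 0\<close> by simp
  qed
  define L where "L = Inf (G ` {0<..})"
  have bdd: "bdd_below (G ` {0<..})" using G0 by (intro bdd_belowI2[of _ 0]) auto
  have L: "L \<le> G t" if "0 < t" for t
    unfolding L_def by (rule cInf_lower) (use that bdd in auto)
  have speed: "AE t in lborel. 0 < t \<longrightarrow> dist (v t) \<phi> < \<epsilon> \<longrightarrow>
      ?md t \<le> 0 \<or> (\<exists>D. (G has_real_derivative D) (at t) \<and> ?md t \<le> - D)"
    unfolding G_def
  proof (rule gradient_flow_speed_bound[OF assms(1,4) \<phi>fin ge assms(12-16)])
    show "AE t in lborel. 0 < t \<longrightarrow> 0 \<le> ?md t" using md by eventually_elim auto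
  qed
  \<comment> \<open>Used twice: small \<open>\<delta>\<close> gives convergence, and
    \<open>\<delta> = \<epsilon>\<close> gives an integrable majorant of the speed on
    \<open>[T, \<infinity>)\<close>.\<close>
  have trap: "\<exists>T>0. (\<forall>t\<ge>T. dist (v t) \<phi> < \<delta>) \<and> (\<exists>w. w \<in> borel_measurable borel \<and> (\<integral>\<^sup>+r. w r \<partial>lborel) < \<infinity> \<and>
      (AE r in lborel. T \<le> r \<longrightarrow> ennreal (?md r) \<le> w r))" if \<delta>: "0 < \<delta>" "\<delta> \<le> \<epsilon>" for \<delta>
  proof -
    from \<open>\<phi> \<in> omega_limit v\<close> obtain \<tau> :: "nat \<Rightarrow> real" where \<tau>: "filterlim \<tau> at_top sequentially" "(\<lambda>n. v (\<tau> n)) \<longlonglongrightarrow> \<phi>"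
      by (auto simp: omega_limit_def)
    have "G ` {0<..} \<noteq> {}" by simp
    moreover have "Inf (G ` {0<..}) < L + \<delta> / 2" using \<delta> by (simp add: L_def)
    ultimately have "\<exists>x\<in>G ` {0<..}. x < L + \<delta> / 2" by (rule cInf_lessD)
    \<comment> \<open>After \<open>t0\<close> less than \<open>\<delta> / 2\<close> of the decrease
      of \<open>G\<close> remains. This persists at the later time \<open>T\<close>, which is taken
      from the sequence converging to \<open>\<phi>\<close>.\<close>
    then obtain t0 where t0: "0 < t0" "G t0 < L + \<delta> / 2" by auto
    have "\<forall>\<^sub>F n in sequentially. t0 \<le> \<tau> n" using \<tau>(1) by (simp add: filterlim_at_top)
    moreover have "\<forall>\<^sub>F n in sequentially. dist (v (\<tau> n)) \<phi> < \<delta> / 2" using \<delta> by (intro tendstoD[OF \<tau>(2)]) simp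
    ultimately have "\<forall>\<^sub>F n in sequentially. t0 \<le> \<tau> n \<and> dist (v (\<tau> n)) \<phi> < \<delta> / 2" by (rule eventually_conj)
    then obtain T where T: "t0 \<le> T" "dist (v T) \<phi> < \<delta> / 2"
      using eventually_happens'[OF sequentially_bot] by blast
    with t0 have T0: "0 < T" by simp
    have GT: "G T - L < \<delta> / 2" using Gmono[OF t0(1) T(1)] t0(2) by simp
    obtain w where w: "w \<in> borel_measurable borel" "(\<integral>\<^sup>+r. w r \<partial>lborel) \<le> ennreal (G T - L)"
      "\<And>r D. T \<le> r \<Longrightarrow> (G has_real_derivative D) (at r) \<Longrightarrow> ennreal (- D) \<le> w r"
    proof (rule nonincreasing_derivative_bound[of T G L])
      show "G t \<le> G s" if "T \<le> s" "s \<le> t" for s t using Gmono that T0 by simp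
      show "L \<le> G t" if "T \<le> t" for t using L that T0 by simp
    qed (rule that)
    have mdw: "AE r in lborel. T \<le> r \<longrightarrow> dist (v r) \<phi> < \<epsilon> \<longrightarrow> ennreal (?md r) \<le> w r"
      using speed
    proof eventually_elim
      case (elim r)
      show ?case
      proof (intro impI)
        assume r: "T \<le> r" "dist (v r) \<phi> < \<epsilon>"
        with elim T0 consider "?md r \<le> 0" | D where "(G has_real_derivative D) (at r)" "?md r \<le> - D" by force
        then show "ennreal (?md r) \<le> w r"
        proof cases
          case 1 then show ?thesis by (simp add: ennreal_neg)
        next
          case 2 then show ?thesis using w(3)[OF r(1)] ennreal_leI order_trans by blast
        qed
      qed
    qed
    have near: "dist (v t) \<phi> < \<delta>" if "T \<le> t" for t
    proof (rule continuous_curve_trapped[where v = v and T = T])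
      show "dist (v T) \<phi> < \<delta> / 2" "T \<le> t" by (rule T(2), rule that)
      show "continuous_on {T..} v" by (rule continuous_on_subset[OF vc]) (use T0 in auto)
      fix t assume t: "T \<le> t" and in_ball: "\<And>r. T \<le> r \<Longrightarrow> r < t \<Longrightarrow> dist (v r) \<phi> < \<delta>"
      have "ennreal (dist (v T) (v t)) \<le> (\<integral>\<^sup>+r\<in>{T..t}. ennreal (?md r) \<partial>lborel)" by (rule vlen[OF T0 t])
      also have "\<dots> \<le> (\<integral>\<^sup>+r. w r \<partial>lborel)"
      proof (rule nn_integral_mono_AE)
        \<comment> \<open>Membership in the ball is known only for \<open>r < t\<close>; the
          endpoint \<open>t\<close> is discarded as a null set.\<close>
        show "AE r in lborel. ennreal (?md r) * indicator {T..t} r \<le> w r"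
          using mdw AE_lborel_singleton[of t]
        proof eventually_elim
          case (elim r)
          show ?case
          proof (cases "r \<in> {T..t}")
            case True
            with elim(2) have "dist (v r) \<phi> < \<epsilon>" using in_ball[of r] \<delta>(2) by force
            with elim(1) True show ?thesis by simp
          qed simp
        qed
      qed
      also have "\<dots> \<le> ennreal (G T - L)" by (rule w(2))
      finally have "dist (v T) (v t) \<le> G T - L" using L[OF T0] by (simp add: ennreal_le_iff)
      with GT show "dist (v T) (v t) < \<delta> / 2" by simp
    qed
    have "AE r in lborel. T \<le> r \<longrightarrow> ennreal (?md r) \<le> w r"
      using mdw
    proof eventually_elim
      case (elim r)
      with near[of r] \<delta>(2) show ?case by fastforce
    qed
    moreover have "(\<integral>\<^sup>+r. w r \<partial>lborel) < \<infinity>" using w(2) by (rule le_less_trans) simp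
    ultimately show ?thesis using T0 near w(1) by blast
  qed
  have "(v \<longlongrightarrow> \<phi>) at_top"
  proof (rule tendstoI)
    fix e :: real assume "0 < e"
    then obtain T where "\<forall>t\<ge>T. dist (v t) \<phi> < min e \<epsilon>"
      using trap[of "min e \<epsilon>"] \<open>\<epsilon> > 0\<close> by auto
    then show "\<forall>\<^sub>F t in at_top. dist (v t) \<phi> < e"
      unfolding eventually_at_top_linorder by auto
  qed
  moreover have "curve_length v < \<infinity>"
  proof -
    from trap[OF \<open>\<epsilon> > 0\<close> order_refl] obtain T w where T: "0 < T" and w: "w \<in> borel_measurable borel"
      "(\<integral>\<^sup>+r. w r \<partial>lborel) < \<infinity>" "AE r in lborel. T \<le> r \<longrightarrow> ennreal (?md r) \<le> w r" by blast
    have mb: "m \<in> borel_measurable borel" by (rule loc_integrable_measurable[OF m(1)])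
    obtain K where K: "primitive_of K m" by (rule loc_integrable_primitive[OF m(1)])
    \<comment> \<open>Before \<open>T\<close> the curve may be far from \<open>\<phi>\<close> and
      the KL bound says nothing; there the length is controlled by \<open>m\<close>, which is
      integrable down to time 0.\<close>
    have "curve_length v \<le> (\<integral>\<^sup>+r. ennreal (m r) * indicator {0..T} r + w r \<partial>lborel)"
      unfolding curve_length_def
    proof (rule nn_integral_mono_AE)
      show "AE r in lborel. ennreal (?md r) * indicator {0<..} r \<le> ennreal (m r) * indicator {0..T} r + w r"
        using md w(3)
      proof eventually_elim
        case (elim r)
        show ?case
        proof (cases "0 < r")
          case True
          show ?thesis
          proof (cases "T \<le> r")
            case True
            then have "ennreal (?md r) \<le> w r" using elim by simp
            then show ?thesis by (simp add: indicator_def add_increasing)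
          next
            case False
            with \<open>0 < r\<close> elim have "ennreal (?md r) \<le> ennreal (m r)" by (intro ennreal_leI) simp
            with False \<open>0 < r\<close> show ?thesis by (simp add: indicator_def add_increasing2)
          qed
        qed simp
      qed
    qed
    also have "\<dots> = (\<integral>\<^sup>+r\<in>{0..T}. ennreal (m r) \<partial>lborel) + (\<integral>\<^sup>+r. w r \<partial>lborel)"
      using mb w(1) by (intro nn_integral_add) auto
    also have "\<dots> < \<infinity>"
      using primitive_nn_integral[OF K m(2), of 0 T] T w(2) by simp
    finally show ?thesis .
  qed
  ultimately show ?thesis by blast
qed

end
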